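(* Let $G=\prod_{i=1}^s G_i$ be a direct product of finite cyclic groups $G_i=\langle a_i\mid a_i^{o_i}=1\rangle$ of orders $o_i$, and let $R=\mathbb{Z}G$. Let $\mathbb{P}_n$ be the $R$-module of homogeneous polynomials of degree $n$ (including $0$) in $R[x_1,x_2,\dots,x_s]$, and for $n\ge 1$ let $d_n:\mathbb{P}_n\to\mathbb{P}_{n-1}$ be the $R$-linear map given on monomials with $k_1+\dots+k_s=n$ by $$d_n(x_1^{k_1}x_2^{k_2}\cdots x_s^{k_s})=\sum_{i=1}^s(-1)^{K_i}\,C_i\,x_1^{k_1}\cdots x_i^{k_i-1}\cdots x_s^{k_s},$$ where $K_i=\sum_{j=1}^{i-1}k_j$ and $$C_i=\begin{cases} a_i-1 & \text{if } k_i \text{ is odd},\\ \sum_{t=0}^{o_i-1}a_i^t & \text{if } k_i>0 \text{ is even},\\ 0 & \text{if } k_i=0.\end{cases}$$ Then $\mathbb{P}=(\mathbb{P}_n,d_n)$ is a free resolution of the $G$-module $\mathbb{Z}$.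
   Context: $\mathbb{Z}$ denotes the trivial $G$-module (every element of $G$ acts as the identity). Here $\mathbb{P}_0=R$, and the augmentation $\mathbb{P}_0=R\to\mathbb{Z}$ is the $\mathbb{Z}$-linear map sending every $g\in G$ to $1$. In the formula for $d_n$, summands with $k_i=0$ are zero. *)

theory Defs
  imports "HOL-Algebra.Algebra"
begin

section \<open>Modules, free modules, free resolutions\<close>

definition module_hom ::
  "('a, 'm) ring_scheme \<Rightarrow> ('a, 'b, 'n) module_scheme \<Rightarrow> ('a, 'c, 'k) module_scheme \<Rightarrow> ('b \<Rightarrow> 'c) set"
  where "module_hom R M N =
    {f \<in> carrier M \<rightarrow> carrier N.
       (\<forall>x\<in>carrier M. \<forall>y\<in>carrier M. f (x \<oplus>\<^bsub>M\<^esub> y) = f x \<oplus>\<^bsub>N\<^esub> f y) \<and>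
       (\<forall>r\<in>carrier R. \<forall>x\<in>carrier M. f (r \<odot>\<^bsub>M\<^esub> x) = r \<odot>\<^bsub>N\<^esub> f x)}"

definition is_basis ::
  "('a, 'm) ring_scheme \<Rightarrow> ('a, 'b, 'n) module_scheme \<Rightarrow> 'b set \<Rightarrow> bool"
  where "is_basis R M B \<longleftrightarrow>
    B \<subseteq> carrier M \<and>
    (\<forall>x\<in>carrier M. \<exists>!c. c \<in> B \<rightarrow> carrier R \<and> (\<forall>b. b \<notin> B \<longrightarrow> c b = \<zero>\<^bsub>R\<^esub>) \<and>
       finite {b \<in> B. c b \<noteq> \<zero>\<^bsub>R\<^esub>} \<and>
       x = (\<Oplus>\<^bsub>M\<^esub>b\<in>{b \<in> B. c b \<noteq> \<zero>\<^bsub>R\<^esub>}. c b \<odot>\<^bsub>M\<^esub> b))"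

definition free_module :: "('a, 'm) ring_scheme \<Rightarrow> ('a, 'b, 'n) module_scheme \<Rightarrow> bool"
  where "free_module R M \<longleftrightarrow> Module.module R M \<and> (\<exists>B. is_basis R M B)"

text \<open>\<open>\<dots> \<rightarrow> P 2 \<rightarrow> P 1 \<rightarrow> P 0 \<rightarrow> M \<rightarrow> 0\<close> is exact, with \<open>d n : P n \<rightarrow> P (n - 1)\<close> for \<open>n \<ge> 1\<close>
  (the value \<open>d 0\<close> is irrelevant) and augmentation \<open>e : P 0 \<rightarrow> M\<close>.\<close>

definition free_resolution ::
  "('a, 'm) ring_scheme \<Rightarrow> (nat \<Rightarrow> ('a, 'b, 'n) module_scheme) \<Rightarrow> (nat \<Rightarrow> 'b \<Rightarrow> 'b)
    \<Rightarrow> ('b \<Rightarrow> 'c) \<Rightarrow> ('a, 'c, 'k) module_scheme \<Rightarrow> bool"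
  where "free_resolution R P d e M \<longleftrightarrow>
    Module.module R M \<and>
    (\<forall>n. free_module R (P n)) \<and>
    (\<forall>n\<ge>1. d n \<in> module_hom R (P n) (P (n - 1))) \<and>
    e \<in> module_hom R (P 0) M \<and>
    e ` carrier (P 0) = carrier M \<and>
    d 1 ` carrier (P 1) = a_kernel (P 0) M e \<and>
    (\<forall>n\<ge>1. d (n + 1) ` carrier (P (n + 1)) = a_kernel (P n) (P (n - 1)) (d n))"


section \<open>The integral group ring\<close>

text \<open>The additive group is the library's free abelian group on \<open>carrier G\<close>; multiplication is
  the bilinear extension of the multiplication of \<open>G\<close>.\<close>

definition group_ring :: "('g, 'm) monoid_scheme \<Rightarrow> ('g \<Rightarrow>\<^sub>0 int) ring"
  where "group_ring G =
    \<lparr>carrier = carrier (free_Abelian_group (carrier G)),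
     monoid.mult = (\<lambda>f h. frag_extend (\<lambda>x. frag_extend (\<lambda>y. frag_of (x \<otimes>\<^bsub>G\<^esub> y)) h) f),
     one = frag_of \<one>\<^bsub>G\<^esub>,
     ring.zero = 0,
     add = (+)\<rparr>"

definition augmentation :: "('g \<Rightarrow>\<^sub>0 int) \<Rightarrow> int"
  where "augmentation f = (\<Sum>g\<in>Poly_Mapping.keys f. Poly_Mapping.lookup f g)"

text \<open>The integers with trivial \<open>G\<close>-action: \<open>\<Sum>\<^sub>g c\<^sub>g g\<close> sends \<open>z\<close> to \<open>\<Sum>\<^sub>g c\<^sub>g z\<close>. The fields
  \<open>mult\<close> and \<open>one\<close> of a module record play no role in the notion of a module.\<close>

definition trivial_module :: "('g \<Rightarrow>\<^sub>0 int, int) module"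
  where "trivial_module =
    \<lparr>carrier = UNIV, monoid.mult = undefined, one = undefined, ring.zero = 0, add = (+),
     smult = (\<lambda>f z. \<Sum>g\<in>Poly_Mapping.keys f. Poly_Mapping.lookup f g * z)\<rparr>"


section \<open>Homogeneous polynomials\<close>

text \<open>Polynomials over \<open>R\<close> in variables indexed by \<open>I\<close> are the library's indexed polynomials: a
  monomial is a multiset \<open>m\<close> over \<open>I\<close>, the exponent of the \<open>i\<close>-th variable is \<open>count m i\<close>, and
  the total degree is \<open>size m\<close>.\<close>

definition homogeneous_polys :: "('a, 'm) ring_scheme \<Rightarrow> 'i set \<Rightarrow> nat \<Rightarrow> ('a, 'i multiset \<Rightarrow> 'a) module"
  where "homogeneous_polys R I n =
    \<lparr>carrier = {p \<in> ring.indexed_pset R I (carrier R). \<forall>m. p m \<noteq> \<zero>\<^bsub>R\<^esub> \<longrightarrow> size m = n},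
     monoid.mult = undefined, one = undefined,
     ring.zero = ring.indexed_const R \<zero>\<^bsub>R\<^esub>,
     add = ring.indexed_padd R,
     smult = (\<lambda>r p m. r \<otimes>\<^bsub>R\<^esub> p m)\<rparr>"

definition monomial :: "('a, 'm) ring_scheme \<Rightarrow> 'i multiset \<Rightarrow> ('i multiset \<Rightarrow> 'a)"
  where "monomial R m = (\<lambda>u. if u = m then \<one>\<^bsub>R\<^esub> else \<zero>\<^bsub>R\<^esub>)"


section \<open>The complex of a product of cyclic groups\<close>

text \<open>The element \<open>x\<close> of the \<open>i\<close>-th factor, viewed in the direct product.\<close>

definition product_embed :: "'i set \<Rightarrow> ('i \<Rightarrow> ('g, 'm) monoid_scheme) \<Rightarrow> 'i \<Rightarrow> 'g \<Rightarrow> ('i \<Rightarrow> 'g)"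
  where "product_embed I G i x = (\<lambda>j\<in>I. if j = i then x else \<one>\<^bsub>G j\<^esub>)"

text \<open>The coefficient \<open>C\<^sub>i\<close>, for a group element \<open>g\<close>, its order \<open>q\<close> and the exponent \<open>k\<close>.\<close>

definition boundary_coeff :: "('g, 'm) monoid_scheme \<Rightarrow> 'g \<Rightarrow> nat \<Rightarrow> nat \<Rightarrow> ('g \<Rightarrow>\<^sub>0 int)"
  where "boundary_coeff G g q k =
    (if k = 0 then 0
     else if odd k then frag_of g - frag_of \<one>\<^bsub>G\<^esub>
     else (\<Sum>t<q. frag_of (g [^]\<^bsub>G\<^esub> t)))"

definition cyclic_product_ring ::
  "nat \<Rightarrow> (nat \<Rightarrow> ('g, 'm) monoid_scheme) \<Rightarrow> ((nat \<Rightarrow> 'g) \<Rightarrow>\<^sub>0 int) ring"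
  where "cyclic_product_ring s G = group_ring (product_group {1..s} G)"

definition PP ::
  "nat \<Rightarrow> (nat \<Rightarrow> ('g, 'm) monoid_scheme) \<Rightarrow> nat
    \<Rightarrow> ((nat \<Rightarrow> 'g) \<Rightarrow>\<^sub>0 int, nat multiset \<Rightarrow> ((nat \<Rightarrow> 'g) \<Rightarrow>\<^sub>0 int)) module"
  where "PP s G n = homogeneous_polys (cyclic_product_ring s G) {1..s} n"

text \<open>The image of the monomial \<open>m\<close>, of degree \<open>n\<close>. For \<open>count m i = 0\<close> the truncated difference
  \<open>m - {#i#}\<close> is just \<open>m\<close>, but then the coefficient is zero.\<close>

definition boundary_monomial ::
  "nat \<Rightarrow> (nat \<Rightarrow> ('g, 'm) monoid_scheme) \<Rightarrow> (nat \<Rightarrow> 'g) \<Rightarrow> (nat \<Rightarrow> nat) \<Rightarrow> nat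
    \<Rightarrow> nat multiset \<Rightarrow> (nat multiset \<Rightarrow> ((nat \<Rightarrow> 'g) \<Rightarrow>\<^sub>0 int))"
  where "boundary_monomial s G a q n m =
    (\<Oplus>\<^bsub>PP s G (n - 1)\<^esub>i\<in>{1..s}.
       frag_cmul ((-1) ^ (\<Sum>j=1..<i. count m j))
         (boundary_coeff (product_group {1..s} G) (product_embed {1..s} G i (a i)) (q i) (count m i))
       \<odot>\<^bsub>PP s G (n - 1)\<^esub> monomial (cyclic_product_ring s G) (m - {#i#}))"

definition boundary ::
  "nat \<Rightarrow> (nat \<Rightarrow> ('g, 'm) monoid_scheme) \<Rightarrow> (nat \<Rightarrow> 'g) \<Rightarrow> (nat \<Rightarrow> nat) \<Rightarrow> nat
    \<Rightarrow> (nat multiset \<Rightarrow> ((nat \<Rightarrow> 'g) \<Rightarrow>\<^sub>0 int)) \<Rightarrow> (nat multiset \<Rightarrow> ((nat \<Rightarrow> 'g) \<Rightarrow>\<^sub>0 int))"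
  where "boundary s G a q n p =
    (\<Oplus>\<^bsub>PP s G (n - 1)\<^esub>m\<in>{m. p m \<noteq> \<zero>\<^bsub>cyclic_product_ring s G\<^esub>}.
       p m \<odot>\<^bsub>PP s G (n - 1)\<^esub> boundary_monomial s G a q n m)"

end

theory Submission
  imports Defs "HOL-Library.Function_Algebras"
begin

text \<open>As complexes of abelian groups, \<open>\<P>\<close> is the signed tensor product of the 2-periodic
  resolutions of the factors: the \<open>\<int>\<close>-basis \<open>g x\<^sup>m\<close> is the product of the bases \<open>a\<^sub>i\<^sup>t x\<^sub>i\<^sup>k\<close>. For
  one factor of order \<open>q\<close> there is the explicit contracting homotopy
  \<open>a\<^sup>t x\<^sup>2\<^sup>j \<mapsto> (\<Sum>u<t. a\<^sup>u) x\<^sup>2\<^sup>j\<^sup>+\<^sup>1\<close>, \<open>a\<^sup>t x\<^sup>2\<^sup>j\<^sup>+\<^sup>1 \<mapsto> [t = q - 1] x\<^sup>2\<^sup>j\<^sup>+\<^sup>2\<close>, for which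
  \<open>\<partial>h + h\<partial> = 1 - e\<close> where \<open>e\<close> is \<open>a\<^sup>t \<mapsto> 1\<close> in degree 0 and vanishes in positive degrees. Operators on
  different coordinates commute, so by induction on the number of factors, with
  \<open>D + \<epsilon>\<partial>\<close>, \<open>H + T h\<close> and \<open>T e\<close> for the new differential, homotopy and projection (\<open>\<epsilon>\<close> the degree
  sign of the earlier factors), \<open>DH + HD = 1 - T\<close> for the whole product.\<close>

section \<open>Local operators and their lifts to a coordinate\<close>

text \<open>The formula for \<open>h\<close> can be read off from the boundary:
  \<open>(a - 1)(1 + ... + a^(t-1)) = a^t - 1\<close> suggests geometric sums in even degrees. In
  odd degrees these already account for every \<open>t < q - 1\<close>; at \<open>t = q - 1\<close>
  the norm element remains, and it is the boundary of one cell. The homotopy is not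
  \<open>R\<close>-linear, but exactness concerns only the underlying abelian groups. The shape
  \<open>H + T h\<close> reflects \<open>1 - T e = (1 - T) + T (1 - e)\<close>: the earlier factors
  are contracted to degree 0, then the last factor is contracted over their image. As
  \<open>T\<close> lands in degree 0, the second piece carries no sign. Chains are arbitrary integer
  functions on labels, and an operator is given by the coefficient it produces at each label.
  Compositions then carry no support conditions; in return, operators must be shown to produce each
  coefficient from finitely many others. Supports matter again only when a chain is compared with a
  polynomial.\<close>

inductive evaluation_combination :: "(('c \<Rightarrow> int) \<Rightarrow> int) \<Rightarrow> bool" where
  eval: "evaluation_combination (\<lambda>f. f z)"
| zero: "evaluation_combination (\<lambda>f. 0)"
| add: "evaluation_combination l \<Longrightarrow> evaluation_combination m \<Longrightarrow> evaluation_combination (\<lambda>f. l f + m f)"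
| uminus: "evaluation_combination l \<Longrightarrow> evaluation_combination (\<lambda>f. - l f)"

lemma evaluation_combination_diff:
  "evaluation_combination l \<Longrightarrow> evaluation_combination m \<Longrightarrow> evaluation_combination (\<lambda>f. l f - m f)"
  using evaluation_combination.add[OF _ evaluation_combination.uminus, of l m] by simp

lemma evaluation_combination_sum:
  assumes "\<And>x. x \<in> A \<Longrightarrow> evaluation_combination (\<lambda>f. l x f)"
  shows "evaluation_combination (\<lambda>f. \<Sum>x\<in>A. l x f)"
proof (cases "finite A")
  case True
  then show ?thesis using assms
    by (induction A) (auto intro: evaluation_combination.intros)
qed (simp add: evaluation_combination.zero)

lemma evaluation_combination_if:
  "(P \<Longrightarrow> evaluation_combination l) \<Longrightarrow> (\<not> P \<Longrightarrow> evaluation_combination m) \<Longrightarrow>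
    evaluation_combination (\<lambda>f. if P then l f else m f)"
  by (cases P) auto

lemma evaluation_combination_signed:
  "evaluation_combination l \<Longrightarrow> evaluation_combination (\<lambda>f. (-1) ^ n * l f)"
  by (cases "even n") (auto intro: evaluation_combination.uminus)

lemma evaluation_combination_zero: "evaluation_combination l \<Longrightarrow> l (\<lambda>_. 0) = 0"
  by (induction rule: evaluation_combination.induct) auto

lemma evaluation_combination_plus:
  "evaluation_combination l \<Longrightarrow> l (\<lambda>z. f z + g z) = l f + l g"
  by (induction rule: evaluation_combination.induct) auto

lemma evaluation_combination_uminus: "evaluation_combination l \<Longrightarrow> l (\<lambda>z. - f z) = - l f"
  by (induction rule: evaluation_combination.induct) auto

text \<open>This is the interchange of two finite sums. The induction unfolds \<open>l\<close> only;
  \<open>m\<close> enters through its additivity.\<close>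

lemma evaluation_combination_commute:
  assumes "evaluation_combination l" "evaluation_combination m"
  shows "l (\<lambda>y. m (\<lambda>z. F y z)) = m (\<lambda>z. l (\<lambda>y. F y z))"
  using assms
  by (induction rule: evaluation_combination.induct)
    (simp_all add: evaluation_combination_zero evaluation_combination_plus[of m]
      evaluation_combination_uminus[of m])

text \<open>Dependence on finitely many input coefficients is recorded syntactically, so that
  interchanging two operators on functions of arbitrary support becomes an induction.\<close>

definition local_op :: "(('c \<Rightarrow> int) \<Rightarrow> 'c \<Rightarrow> int) \<Rightarrow> bool" where
  "local_op \<phi> \<longleftrightarrow> (\<forall>y. evaluation_combination (\<lambda>f. \<phi> f y))"

text \<open>The tensor product of \<open>\<phi>\<close> in factor \<open>i\<close> with identities
  elsewhere: the other coordinates are frozen. No Koszul sign is built in; signs are inserted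
  separately by \<open>tot_sign\<close>.\<close>

definition lift_op :: "'i \<Rightarrow> (('c \<Rightarrow> int) \<Rightarrow> 'c \<Rightarrow> int) \<Rightarrow> (('i \<Rightarrow> 'c) \<Rightarrow> int) \<Rightarrow> ('i \<Rightarrow> 'c) \<Rightarrow> int" where
  "lift_op i \<phi> F w = \<phi> (\<lambda>y. F (w(i := y))) (w i)"

lemma additive_lift_op:
  assumes "local_op \<phi>"
  shows "additive (lift_op i \<phi>)"
proof
  have "\<phi> (\<lambda>z. f z + g z) y = \<phi> f y + \<phi> g y" for f g y
    using evaluation_combination_plus[of "\<lambda>f. \<phi> f y"] assms by (auto simp: local_op_def)
  then show "lift_op i \<phi> (F + H) = lift_op i \<phi> F + lift_op i \<phi> H" for F H
    by (simp add: fun_eq_iff lift_op_def)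
qed

lemma lift_op_commute:
  assumes "i \<noteq> j" "local_op \<phi>" "local_op \<psi>"
  shows "lift_op i \<phi> (lift_op j \<psi> F) = lift_op j \<psi> (lift_op i \<phi> F)"
proof
  fix w
  have "\<phi> (\<lambda>y. \<psi> (\<lambda>z. F (w(i := y, j := z))) (w j)) (w i)
      = \<psi> (\<lambda>z. \<phi> (\<lambda>y. F (w(i := y, j := z))) (w i)) (w j)"
    using evaluation_combination_commute[of "\<lambda>f. \<phi> f (w i)" "\<lambda>f. \<psi> f (w j)"] assms(2,3)
    by (auto simp: local_op_def)
  then show "lift_op i \<phi> (lift_op j \<psi> F) w = lift_op j \<psi> (lift_op i \<phi> F) w"
    using assms(1) by (simp add: lift_op_def fun_upd_twist)
qed

section \<open>The resolution of a single cyclic group\<close>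

text \<open>The basis element \<open>a\<^sup>t x\<^sup>k\<close> of the resolution of a cyclic group of order \<open>q\<close> is the pair
  \<open>(k, t)\<close> with \<open>t < q\<close>, and a chain is the function of its coefficients. On the junk pairs
  \<open>t \<ge> q\<close> the differential and the homotopy vanish while the projection and the sign are the
  identity, so that all identities hold for arbitrary functions.\<close>

definition cyc_pred :: "nat \<Rightarrow> nat \<Rightarrow> nat" where
  "cyc_pred q t = (if t = 0 then q - 1 else t - 1)"

definition cyc_bd :: "nat \<Rightarrow> (nat \<times> nat \<Rightarrow> int) \<Rightarrow> nat \<times> nat \<Rightarrow> int" where
  "cyc_bd q f = (\<lambda>(k, t). if t < q
     then if even k then f (k + 1, cyc_pred q t) - f (k + 1, t) else \<Sum>u<q. f (k + 1, u)
     else 0)"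

definition cyc_htp :: "nat \<Rightarrow> (nat \<times> nat \<Rightarrow> int) \<Rightarrow> nat \<times> nat \<Rightarrow> int" where
  "cyc_htp q f = (\<lambda>(k, t). if t < q \<and> 0 < k
     then if odd k then \<Sum>u\<in>{t<..<q}. f (k - 1, u) else if t = 0 then f (k - 1, q - 1) else 0
     else 0)"

definition cyc_proj :: "nat \<Rightarrow> (nat \<times> nat \<Rightarrow> int) \<Rightarrow> nat \<times> nat \<Rightarrow> int" where
  "cyc_proj q f = (\<lambda>(k, t). if t < q then if k = 0 \<and> t = 0 then \<Sum>u<q. f (0, u) else 0 else f (k, t))"

definition cyc_sign :: "nat \<Rightarrow> (nat \<times> nat \<Rightarrow> int) \<Rightarrow> nat \<times> nat \<Rightarrow> int" where
  "cyc_sign q f = (\<lambda>(k, t). if t < q then (-1) ^ k * f (k, t) else f (k, t))"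

lemma local_op_cyc [simp]:
  "local_op (cyc_bd q)" "local_op (cyc_htp q)" "local_op (cyc_proj q)" "local_op (cyc_sign q)"
  unfolding local_op_def cyc_bd_def cyc_htp_def cyc_proj_def cyc_sign_def split_paired_All prod.case
  by (intro allI evaluation_combination_if evaluation_combination_sum evaluation_combination_diff
      evaluation_combination_signed evaluation_combination.intros)+

lemma sum_cyc_pred:
  fixes f :: "nat \<Rightarrow> int"
  shows "(\<Sum>t<q. f (cyc_pred q t)) = sum f {..<q}"
proof (cases q)
  case (Suc m)
  show ?thesis
    unfolding Suc by (subst sum.lessThan_Suc_shift) (simp add: cyc_pred_def)
qed simp

text \<open>The coefficients of a multiple of \<open>a - 1\<close> add up to zero. Hence both the
  norm and the projection annihilate boundaries coming from odd degree.\<close>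

lemma sum_cyc_pred_diff:
  fixes f :: "nat \<Rightarrow> int"
  shows "(\<Sum>t<q. f (cyc_pred q t) - f t) = 0"
  by (simp add: sum_subtractf sum_cyc_pred)

text \<open>At even \<open>k\<close> a norm, whose coefficients do not depend on \<open>t\<close>,
  is differenced; at odd \<open>k\<close> differences are summed over a full cycle.\<close>

lemma cyc_bd_bd: "cyc_bd q (cyc_bd q f) y = 0"
  using sum_cyc_pred_diff[of "\<lambda>u. f (fst y + 2, u)" q]
  by (cases y) (simp add: cyc_bd_def cyc_pred_def)

lemma cyc_proj_bd: "cyc_proj q (cyc_bd q f) y = 0"
  using sum_cyc_pred_diff[of "\<lambda>u. f (1, u)" q]
  by (cases y) (simp add: cyc_bd_def cyc_proj_def)

text \<open>On proper labels the projection is nonzero only in degree 0, whereas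
  \<open>cyc_bd\<close> reads degree \<open>k + 1\<close>. As \<open>cyc_pred q t\<close> stays
  below \<open>q\<close> when \<open>t\<close> does, junk values never enter.\<close>

lemma cyc_bd_proj: "cyc_bd q (cyc_proj q f) y = 0"
  by (cases y) (auto simp: cyc_bd_def cyc_proj_def cyc_pred_def)

lemma cyc_sign_bd: "cyc_sign q (cyc_bd q f) y = - cyc_bd q (cyc_sign q f) y"
  by (cases y) (auto simp: cyc_sign_def cyc_bd_def cyc_pred_def sum_negf)

lemma cyc_sign_htp: "cyc_sign q (cyc_htp q f) y = - cyc_htp q (cyc_sign q f) y"
  by (cases y) (auto simp: cyc_sign_def cyc_htp_def sum_negf)

lemma cyc_sign_proj: "cyc_sign q (cyc_proj q f) y = cyc_proj q f y"
  by (cases y) (simp add: cyc_sign_def cyc_proj_def)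

lemma cyc_proj_sign: "cyc_proj q (cyc_sign q f) y = cyc_proj q f y"
  by (cases y) (simp add: cyc_sign_def cyc_proj_def)

text \<open>At odd \<open>k\<close>, \<open>\<partial>h\<close> contributes the last coefficient for
  every \<open>t\<close>, and \<open>h\<partial>\<close> telescopes to the current coefficient minus
  the last one. At even \<open>k\<close>, \<open>\<partial>h\<close> is a difference of neighbouring
  tail sums and fails only at \<open>t = 0\<close>, where the missing total is supplied by
  \<open>h\<partial>\<close> if \<open>k > 0\<close> and by the projection if
  \<open>k = 0\<close>.\<close>

lemma cyc_homotopy: "cyc_bd q (cyc_htp q f) y + cyc_htp q (cyc_bd q f) y = f y - cyc_proj q f y"
proof -
  obtain k t where y: "y = (k, t)" by (cases y)
  consider "\<not> t < q" | "t < q" "odd k" | "t < q" "even k" by blast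
  then show ?thesis
  proof cases
    case 1
    then show ?thesis by (simp add: y cyc_bd_def cyc_htp_def cyc_proj_def)
  next
    case 2
    define g where "g = (\<lambda>u. f (k, u))"
    have "(\<Sum>u\<in>{t<..<q}. g (cyc_pred q u) - g u) = (\<Sum>u\<in>{Suc t..<q}. g (u - 1) - g u)"
      by (rule sum.cong) (auto simp: cyc_pred_def)
    also have "\<dots> = (\<Sum>u\<in>{t..<q - 1}. g u - g (Suc u))"
      using 2 sum.shift_bounds_Suc_ivl[of "\<lambda>u. g (u - 1) - g u" t "q - 1"] by simp
    also have "\<dots> = g t - g (q - 1)"
      using 2 sum_Suc_diff'[of t "q - 1" "\<lambda>u. - g u"] by (simp add: algebra_simps)
    finally have *: "(\<Sum>u\<in>{t<..<q}. g (cyc_pred q u) - g u) = g t - g (q - 1)" .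
    have "cyc_bd q (cyc_htp q f) y = (\<Sum>u<q. if u = 0 then g (q - 1) else 0)"
      using 2 by (simp add: y g_def cyc_bd_def cyc_htp_def)
    also have "\<dots> = g (q - 1)" using 2 by simp
    finally have "cyc_bd q (cyc_htp q f) y = g (q - 1)" .
    moreover have "cyc_htp q (cyc_bd q f) y = (\<Sum>u\<in>{t<..<q}. g (cyc_pred q u) - g u)"
      using 2 by (auto simp: y g_def cyc_bd_def cyc_htp_def intro!: sum.cong)
    moreover have "f y - cyc_proj q f y = g t"
      using 2 by (auto simp: y g_def cyc_proj_def)
    ultimately show ?thesis using * by simp
  next
    case 3
    define g where "g = (\<lambda>u. f (k, u))"
    have split: "sum g {..<q} = g 0 + sum g {0<..<q}"
    proof -
      have "{..<q} = insert 0 {0<..<q}" using 3 by auto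
      then show ?thesis by simp
    qed
    \<comment> \<open>At \<open>t = 0\<close> the predecessor wraps around to \<open>q - 1\<close>,
      beyond which the tail is empty; elsewhere the two tails differ by the single index
      \<open>t\<close>.\<close>
    have tails: "sum g {cyc_pred q t<..<q} - sum g {t<..<q} = (if t = 0 then - sum g {0<..<q} else g t)"
    proof (cases "t = 0")
      case True
      have "{q - Suc 0<..<q} = {}" by auto
      then show ?thesis using True by (simp add: cyc_pred_def)
    next
      case False
      then have "{t - 1<..<q} = insert t {t<..<q}" using 3 by auto
      then show ?thesis using False by (simp add: cyc_pred_def)
    qed
    have "cyc_bd q (cyc_htp q f) y = sum g {cyc_pred q t<..<q} - sum g {t<..<q}"
      using 3 by (auto simp: y g_def cyc_bd_def cyc_htp_def cyc_pred_def)
    moreover have "cyc_htp q (cyc_bd q f) y = (if 0 < k \<and> t = 0 then sum g {..<q} else 0)"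
      using 3 by (auto simp: y g_def cyc_bd_def cyc_htp_def)
    moreover have "cyc_proj q f y = (if k = 0 \<and> t = 0 then sum g {..<q} else 0)"
      using 3 by (auto simp: y g_def cyc_proj_def)
    ultimately show ?thesis using tails split by (auto simp: y g_def)
  qed
qed

section \<open>The tensor product of the resolutions\<close>

type_synonym chain = "(nat \<Rightarrow> nat \<times> nat) \<Rightarrow> int"

text \<open>Carrying the degree sign as an operator, instead of a power of \<open>-1\<close> in each
  formula, lets the Koszul signs be handled by commutation rules alone.\<close>

primrec tot_sign :: "(nat \<Rightarrow> nat) \<Rightarrow> nat \<Rightarrow> chain \<Rightarrow> chain" where
  "tot_sign q 0 F = F"
| "tot_sign q (Suc n) F = tot_sign q n (lift_op (Suc n) (cyc_sign (q (Suc n))) F)"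

primrec tot_proj :: "(nat \<Rightarrow> nat) \<Rightarrow> nat \<Rightarrow> chain \<Rightarrow> chain" where
  "tot_proj q 0 F = F"
| "tot_proj q (Suc n) F = tot_proj q n (lift_op (Suc n) (cyc_proj (q (Suc n))) F)"

primrec tot_bd :: "(nat \<Rightarrow> nat) \<Rightarrow> nat \<Rightarrow> chain \<Rightarrow> chain" where
  "tot_bd q 0 F = 0"
| "tot_bd q (Suc n) F = tot_bd q n F + tot_sign q n (lift_op (Suc n) (cyc_bd (q (Suc n))) F)"

primrec tot_htp :: "(nat \<Rightarrow> nat) \<Rightarrow> nat \<Rightarrow> chain \<Rightarrow> chain" where
  "tot_htp q 0 F = 0"
| "tot_htp q (Suc n) F = tot_htp q n F + tot_proj q n (lift_op (Suc n) (cyc_htp (q (Suc n))) F)"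

lemmas lift_op_add = additive.add[OF additive_lift_op]
lemmas lift_op_zero = additive.zero[OF additive_lift_op]

lemma additive_tot:
  "additive (tot_sign q n)" "additive (tot_proj q n)" "additive (tot_bd q n)" "additive (tot_htp q n)"
proof -
  show sign: "additive (tot_sign q n)" for n
    by (induction n) (auto simp: additive_def lift_op_add)
  show proj: "additive (tot_proj q n)" for n
    by (induction n) (auto simp: additive_def lift_op_add)
  show "additive (tot_bd q n)"
    using sign by (induction n) (auto simp: additive_def lift_op_add)
  show "additive (tot_htp q n)"
    using proj by (induction n) (auto simp: additive_def lift_op_add)
qed

lemmas tot_add = additive_tot[THEN additive.add]
lemmas tot_zero = additive_tot[THEN additive.zero]
lemmas tot_minus = additive_tot[THEN additive.minus]

text \<open>The total operators involve only coordinates up to \<open>n\<close>. Read from right to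
  left, these rules bring two lifts at the same later coordinate next to each other, where the
  one-factor identities apply.\<close>

lemma tot_lift_op:
  assumes "local_op \<phi>" "n < j"
  shows "tot_sign q n (lift_op j \<phi> F) = lift_op j \<phi> (tot_sign q n F)"
    and "tot_proj q n (lift_op j \<phi> F) = lift_op j \<phi> (tot_proj q n F)"
    and "tot_bd q n (lift_op j \<phi> F) = lift_op j \<phi> (tot_bd q n F)"
    and "tot_htp q n (lift_op j \<phi> F) = lift_op j \<phi> (tot_htp q n F)"
proof -
  note comm = lift_op_commute[OF _ local_op_cyc(1) assms(1)] lift_op_commute[OF _ local_op_cyc(2) assms(1)]
    lift_op_commute[OF _ local_op_cyc(3) assms(1)] lift_op_commute[OF _ local_op_cyc(4) assms(1)]
  have sign: "n < j \<Longrightarrow> tot_sign q n (lift_op j \<phi> F) = lift_op j \<phi> (tot_sign q n F)" for n F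
    by (induction n arbitrary: F) (simp_all add: comm)
  have proj: "n < j \<Longrightarrow> tot_proj q n (lift_op j \<phi> F) = lift_op j \<phi> (tot_proj q n F)" for n F
    by (induction n arbitrary: F) (simp_all add: comm)
  have bd: "n < j \<Longrightarrow> tot_bd q n (lift_op j \<phi> F) = lift_op j \<phi> (tot_bd q n F)" for n F
    by (induction n arbitrary: F)
      (simp_all add: comm sign lift_op_zero[OF assms(1)] lift_op_add[OF assms(1)])
  have htp: "n < j \<Longrightarrow> tot_htp q n (lift_op j \<phi> F) = lift_op j \<phi> (tot_htp q n F)" for n F
    by (induction n arbitrary: F)
      (simp_all add: comm proj lift_op_zero[OF assms(1)] lift_op_add[OF assms(1)])
  show "tot_sign q n (lift_op j \<phi> F) = lift_op j \<phi> (tot_sign q n F)"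
    and "tot_proj q n (lift_op j \<phi> F) = lift_op j \<phi> (tot_proj q n F)"
    and "tot_bd q n (lift_op j \<phi> F) = lift_op j \<phi> (tot_bd q n F)"
    and "tot_htp q n (lift_op j \<phi> F) = lift_op j \<phi> (tot_htp q n F)"
    using sign proj bd htp assms(2) by blast+
qed

text \<open>The one-factor identities hold for arbitrary functions, hence for each function of
  coordinate \<open>i\<close> obtained by freezing the others.\<close>

lemma lift_cyc:
  "lift_op i (cyc_bd q) (lift_op i (cyc_bd q) F) = 0"
  "lift_op i (cyc_proj q) (lift_op i (cyc_bd q) F) = 0"
  "lift_op i (cyc_bd q) (lift_op i (cyc_proj q) F) = 0"
  "lift_op i (cyc_sign q) (lift_op i (cyc_bd q) F) = - lift_op i (cyc_bd q) (lift_op i (cyc_sign q) F)"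
  "lift_op i (cyc_sign q) (lift_op i (cyc_htp q) F) = - lift_op i (cyc_htp q) (lift_op i (cyc_sign q) F)"
  "lift_op i (cyc_sign q) (lift_op i (cyc_proj q) F) = lift_op i (cyc_proj q) F"
  "lift_op i (cyc_proj q) (lift_op i (cyc_sign q) F) = lift_op i (cyc_proj q) F"
  "lift_op i (cyc_bd q) (lift_op i (cyc_htp q) F) + lift_op i (cyc_htp q) (lift_op i (cyc_bd q) F)
    = F - lift_op i (cyc_proj q) F"
  by (simp_all add: fun_eq_iff lift_op_def cyc_bd_bd cyc_proj_bd cyc_bd_proj cyc_sign_bd
      cyc_sign_htp cyc_sign_proj cyc_proj_sign cyc_homotopy)

text \<open>The projection lands in degree 0, where the sign is \<open>1\<close>; on junk
  coordinates both operators are the identity.\<close>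

lemma tot_sign_proj: "tot_sign q n (tot_proj q n F) = tot_proj q n F"
  by (induction n arbitrary: F) (simp_all add: lift_cyc flip: tot_lift_op(2))

lemma tot_proj_sign: "tot_proj q n (tot_sign q n F) = tot_proj q n F"
  by (induction n arbitrary: F) (simp_all add: lift_cyc flip: tot_lift_op(1))

text \<open>Parity: the boundary changes the total degree by one. In the new summand the sign of the
  earlier coordinates commutes with everything at the last one, so the minus comes from the last
  coordinate alone.\<close>

lemma tot_sign_bd: "tot_sign q n (tot_bd q n F) = - tot_bd q n (tot_sign q n F)"
proof (induction n arbitrary: F)
  case (Suc n)
  let ?s = "lift_op (Suc n) (cyc_sign (q (Suc n)))" and ?d = "lift_op (Suc n) (cyc_bd (q (Suc n)))"
  have "tot_sign q (Suc n) (tot_bd q (Suc n) F)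
      = tot_sign q n (tot_bd q n (?s F)) + tot_sign q n (?s (tot_sign q n (?d F)))"
    by (simp only: tot_sign.simps tot_bd.simps tot_htp.simps tot_add lift_op_add local_op_cyc lessI
        flip: tot_lift_op(3,4))
  also have "?s (tot_sign q n (?d F)) = - tot_sign q n (?d (?s F))"
    by (simp only: lift_cyc tot_minus local_op_cyc lessI flip: tot_lift_op(1))
  also have "tot_sign q n (tot_bd q n (?s F)) = - tot_bd q n (tot_sign q n (?s F))"
    by (rule Suc)
  finally have "tot_sign q (Suc n) (tot_bd q (Suc n) F)
      = - tot_bd q n (tot_sign q n (?s F)) + tot_sign q n (- tot_sign q n (?d (?s F)))" .
  moreover have "tot_sign q n (?d (?s F)) = ?d (tot_sign q n (?s F))"
    by (rule tot_lift_op(1)) simp_all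
  ultimately show ?case
    by (simp only: tot_bd.simps tot_sign.simps tot_minus minus_add_distrib)
qed (simp add: tot_zero)

text \<open>Again parity; here the signs of the earlier coordinates are absorbed by
  \<open>T\<close>, from either side.\<close>

lemma tot_sign_htp: "tot_sign q n (tot_htp q n F) = - tot_htp q n (tot_sign q n F)"
proof (induction n arbitrary: F)
  case (Suc n)
  let ?s = "lift_op (Suc n) (cyc_sign (q (Suc n)))" and ?h = "lift_op (Suc n) (cyc_htp (q (Suc n)))"
  have "tot_sign q (Suc n) (tot_htp q (Suc n) F)
      = tot_sign q n (tot_htp q n (?s F)) + tot_sign q n (?s (tot_proj q n (?h F)))"
    by (simp only: tot_sign.simps tot_bd.simps tot_htp.simps tot_add lift_op_add local_op_cyc lessI
        flip: tot_lift_op(3,4))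
  also have "?s (tot_proj q n (?h F)) = - tot_proj q n (?h (?s F))"
    by (simp only: lift_cyc tot_minus local_op_cyc lessI flip: tot_lift_op(2))
  also have "tot_sign q n (tot_htp q n (?s F)) = - tot_htp q n (tot_sign q n (?s F))"
    by (rule Suc)
  finally have "tot_sign q (Suc n) (tot_htp q (Suc n) F)
      = - tot_htp q n (tot_sign q n (?s F)) + - tot_proj q n (?h (?s F))"
    by (simp only: tot_minus tot_sign_proj)
  moreover have "?h (tot_sign q n (?s F)) = tot_sign q n (?h (?s F))"
    by (rule tot_lift_op(1)[symmetric]) simp_all
  ultimately show ?case
    by (simp only: tot_htp.simps tot_sign.simps tot_proj_sign minus_add_distrib)
qed (simp add: tot_zero)

text \<open>Each factor satisfies \<open>\<partial>e = 0\<close>, and the boundary at one coordinate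
  passes the projections at the others.\<close>

lemma tot_bd_proj: "tot_bd q n (tot_proj q n F) = 0"
proof (induction n arbitrary: F)
  case (Suc n)
  let ?d = "lift_op (Suc n) (cyc_bd (q (Suc n)))" and ?e = "lift_op (Suc n) (cyc_proj (q (Suc n)))"
  have "?d (tot_proj q n (?e F)) = tot_proj q n (?d (?e F))"
    by (rule tot_lift_op(2)[symmetric]) simp_all
  also have "\<dots> = 0" by (simp only: lift_cyc tot_zero)
  finally show ?case by (simp add: Suc tot_zero)
qed simp

lemma tot_proj_bd: "tot_proj q n (tot_bd q n F) = 0"
proof (induction n arbitrary: F)
  case (Suc n)
  let ?d = "lift_op (Suc n) (cyc_bd (q (Suc n)))" and ?e = "lift_op (Suc n) (cyc_proj (q (Suc n)))"
  have "?e (tot_bd q n F) = tot_bd q n (?e F)"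
    by (rule tot_lift_op(3)[symmetric]) simp_all
  moreover have "?e (tot_sign q n (?d F)) = 0"
    by (simp only: lift_cyc tot_zero local_op_cyc lessI flip: tot_lift_op(1))
  ultimately show ?case
    by (simp only: tot_bd.simps tot_proj.simps tot_add lift_op_add local_op_cyc Suc tot_zero add_0_left)
qed (simp add: tot_zero)

text \<open>The two mixed terms cancel because \<epsilon> anticommutes with the earlier boundary,
  which is what the Koszul sign is for.\<close>

lemma tot_bd_bd: "tot_bd q n (tot_bd q n F) = 0"
proof (induction n arbitrary: F)
  case (Suc n)
  let ?d = "lift_op (Suc n) (cyc_bd (q (Suc n)))"
  have "tot_bd q (Suc n) (tot_bd q (Suc n) F)
      = tot_bd q n (tot_sign q n (?d F)) + tot_sign q n (?d (tot_bd q n F))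
        + tot_sign q n (?d (tot_sign q n (?d F)))"
    by (simp only: tot_bd.simps tot_add lift_op_add local_op_cyc Suc add_0_left add_ac)
  also have "tot_sign q n (?d (tot_bd q n F)) = - tot_bd q n (tot_sign q n (?d F))"
    by (simp add: tot_sign_bd flip: tot_lift_op(3))
  also have "?d (tot_sign q n (?d F)) = 0"
    by (simp only: lift_cyc tot_zero local_op_cyc lessI flip: tot_lift_op(1))
  finally show ?case by (simp only: tot_zero add.right_neutral right_minus)
qed simp

text \<open>Of the eight terms, \<open>D H + H D\<close> is the induction hypothesis,
  \<open>D T h\<close> and \<open>T h D\<close> vanish, and \<open>\<epsilon>\<partial>H\<close>
  cancels \<open>H\<epsilon>\<partial>\<close> by parity. In the last two \<epsilon> is absorbed by
  \<open>T\<close>, leaving \<open>T(\<partial>h + h\<partial>) = T - T e\<close>, whose first term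
  cancels the \<open>- T\<close> of the induction hypothesis.\<close>

lemma tot_homotopy: "tot_bd q n (tot_htp q n F) + tot_htp q n (tot_bd q n F) = F - tot_proj q n F"
proof (induction n arbitrary: F)
  case (Suc n)
  let ?d = "lift_op (Suc n) (cyc_bd (q (Suc n)))" and ?h = "lift_op (Suc n) (cyc_htp (q (Suc n)))"
    and ?e = "lift_op (Suc n) (cyc_proj (q (Suc n)))"
  let ?D = "tot_bd q n" and ?H = "tot_htp q n" and ?S = "tot_sign q n" and ?T = "tot_proj q n"
  have "tot_bd q (Suc n) (tot_htp q (Suc n) F) + tot_htp q (Suc n) (tot_bd q (Suc n) F)
      = (?D (?H F) + ?H (?D F)) + ?D (?T (?h F)) + ?T (?h (?D F))
        + (?S (?d (?H F)) + ?H (?S (?d F))) + (?S (?d (?T (?h F))) + ?T (?h (?S (?d F))))"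
    by (simp only: tot_bd.simps tot_htp.simps tot_add lift_op_add local_op_cyc add_ac)
  moreover have "?D (?T (?h F)) = 0" by (rule tot_bd_proj)
  moreover have "?T (?h (?D F)) = 0"
    by (simp only: tot_proj_bd local_op_cyc lessI flip: tot_lift_op(3))
  moreover have "?S (?d (?H F)) = - ?H (?S (?d F))"
    by (simp only: tot_sign_htp local_op_cyc lessI flip: tot_lift_op(4))
  moreover have "?S (?d (?T (?h F))) = ?T (?d (?h F))"
    by (simp only: tot_sign_proj local_op_cyc lessI flip: tot_lift_op(2))
  moreover have "?T (?h (?S (?d F))) = ?T (?h (?d F))"
    by (simp only: tot_proj_sign local_op_cyc lessI flip: tot_lift_op(1))
  moreover have "?T (?d (?h F)) + ?T (?h (?d F)) = ?T F - ?T (?e F)"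
    by (simp only: lift_cyc(8) additive.diff[OF additive_tot(2)] flip: tot_add(2))
  ultimately show ?case
    by (simp only: Suc tot_proj.simps add_0_right left_minus add_diff_eq diff_add_cancel)
qed (simp add: fun_eq_iff)

section \<open>Values of the total operators at a single label\<close>

lemma tot_sign_apply:
  assumes "\<And>j. j \<in> {1..n} \<Longrightarrow> snd (w j) < q j"
  shows "tot_sign q n F w = (-1) ^ (\<Sum>j=1..n. fst (w j)) * F w"
  using assms
proof (induction n arbitrary: F)
  case (Suc n)
  have "lift_op (Suc n) (cyc_sign (q (Suc n))) F w = (-1) ^ fst (w (Suc n)) * F w"
    using Suc.prems[of "Suc n"] by (cases "w (Suc n)") (auto simp: lift_op_def cyc_sign_def fun_upd_idem)
  then show ?case
    using Suc by (simp add: power_add)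
qed simp

text \<open>The nested recursion unfolds to the sign \<open>(-1)^K_i\<close> of the polynomial
  boundary. The label must be proper because the sign operator ignores the degree of a junk
  coordinate.\<close>

lemma tot_bd_apply:
  assumes "\<And>j. j \<in> {1..n} \<Longrightarrow> snd (w j) < q j"
  shows "tot_bd q n F w
    = (\<Sum>i=1..n. (-1) ^ (\<Sum>j=1..<i. fst (w j)) * cyc_bd (q i) (\<lambda>y. F (w(i := y))) (w i))"
  using assms
proof (induction n)
  case (Suc n)
  have "tot_sign q n (lift_op (Suc n) (cyc_bd (q (Suc n))) F) w
      = (-1) ^ (\<Sum>j=1..n. fst (w j)) * lift_op (Suc n) (cyc_bd (q (Suc n))) F w"
    using Suc.prems by (intro tot_sign_apply) simp
  then show ?case
    using Suc.IH Suc.prems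
    by (simp add: lift_op_def atLeastLessThanSuc_atLeastAtMost del: fun_upd_apply)
qed simp

lemma tot_sign_eq_0: "F w = 0 \<Longrightarrow> tot_sign q n F w = 0"
proof (induction n arbitrary: F)
  case (Suc n)
  have "lift_op (Suc n) (cyc_sign (q (Suc n))) F w = 0"
    using Suc.prems by (cases "w (Suc n)") (auto simp: lift_op_def cyc_sign_def fun_upd_idem)
  then show ?case using Suc.IH by simp
qed simp

text \<open>Signs act pointwise by \<open>1\<close> or \<open>-1\<close>, so vanishing can be
  checked termwise even at labels with junk coordinates, which the explicit formula does not
  cover.\<close>

lemma tot_bd_eq_0:
  assumes "\<And>i. i \<in> {1..n} \<Longrightarrow> cyc_bd (q i) (\<lambda>y. F (w(i := y))) (w i) = 0"
  shows "tot_bd q n F w = 0"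
  using assms
proof (induction n)
  case (Suc n)
  have "tot_sign q n (lift_op (Suc n) (cyc_bd (q (Suc n))) F) w = 0"
    using Suc.prems[of "Suc n"] by (intro tot_sign_eq_0) (simp add: lift_op_def del: fun_upd_apply)
  then show ?case using Suc by simp
qed simp

lemma tot_proj_apply_zero:
  assumes "j \<in> {1..n}" "snd (w j) < q j" "w j \<noteq> (0, 0)"
  shows "tot_proj q n F w = 0"
proof -
  have "tot_proj q n F w = 0" if "j \<le> n" for F
    using that
  proof (induction n arbitrary: F)
    case (Suc n)
    show ?case
    proof (cases "j = Suc n")
      case True
      \<comment> \<open>Projections at distinct coordinates commute, so the one at \<open>j\<close>
        may be taken outermost, where its value at \<open>w\<close> is zero.\<close>
      have "tot_proj q (Suc n) F w = lift_op j (cyc_proj (q j)) (tot_proj q n F) w"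
        by (simp add: True tot_lift_op)
      also have "\<dots> = 0"
        using assms(2,3) by (cases "w j") (auto simp: lift_op_def cyc_proj_def)
      finally show ?thesis .
    next
      case False
      then show ?thesis using Suc by simp
    qed
  qed (use assms in simp)
  then show ?thesis using assms(1) by simp
qed

section \<open>The integral group ring\<close>

lemma group_ring_simps [simp]:
  "carrier (group_ring G) = {f. Poly_Mapping.keys f \<subseteq> carrier G}"
  "\<zero>\<^bsub>group_ring G\<^esub> = 0"
  "\<one>\<^bsub>group_ring G\<^esub> = frag_of \<one>\<^bsub>G\<^esub>"
  "f \<oplus>\<^bsub>group_ring G\<^esub> h = f + h"
  by (auto simp: group_ring_def)

lemma group_ring_mult:
  "f \<otimes>\<^bsub>group_ring G\<^esub> h = frag_extend (\<lambda>x. frag_extend (\<lambda>y. frag_of (x \<otimes>\<^bsub>G\<^esub> y)) h) f"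
  by (simp add: group_ring_def)

lemma group_ring_mult_diff_left:
  "(f - f') \<otimes>\<^bsub>group_ring G\<^esub> h = f \<otimes>\<^bsub>group_ring G\<^esub> h - f' \<otimes>\<^bsub>group_ring G\<^esub> h"
  by (simp add: group_ring_mult frag_extend_diff)

lemma group_ring_mult_add_left:
  "(f + f') \<otimes>\<^bsub>group_ring G\<^esub> h = f \<otimes>\<^bsub>group_ring G\<^esub> h + f' \<otimes>\<^bsub>group_ring G\<^esub> h"
  by (simp add: group_ring_mult frag_extend_add)

lemma group_ring_mult_zero [simp]:
  "0 \<otimes>\<^bsub>group_ring G\<^esub> h = 0" "h \<otimes>\<^bsub>group_ring G\<^esub> 0 = 0"
  by (simp_all add: group_ring_mult frag_extend_eq_0)

lemma group_ring_mult_cmul: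
  "f \<otimes>\<^bsub>group_ring G\<^esub> frag_cmul c h = frag_cmul c (f \<otimes>\<^bsub>group_ring G\<^esub> h)"
  unfolding group_ring_mult frag_extend_cmul
  by (simp add: frag_extend_def[of _ f] frag_cmul_sum mult.commute)

lemma group_ring_mult_minus_right: "f \<otimes>\<^bsub>group_ring G\<^esub> (- h) = - (f \<otimes>\<^bsub>group_ring G\<^esub> h)"
  using group_ring_mult_cmul[of G f "-1" h] by simp

lemma group_ring_mult_add_right:
  "f \<otimes>\<^bsub>group_ring G\<^esub> (h + h') = f \<otimes>\<^bsub>group_ring G\<^esub> h + f \<otimes>\<^bsub>group_ring G\<^esub> h'"
  by (simp add: group_ring_mult frag_extend_add)
    (simp add: frag_extend_def frag_cmul_distrib2 sum.distrib)

lemma group_ring_mult_diff_right: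
  "f \<otimes>\<^bsub>group_ring G\<^esub> (h - h') = f \<otimes>\<^bsub>group_ring G\<^esub> h - f \<otimes>\<^bsub>group_ring G\<^esub> h'"
  using group_ring_mult_add_right[of G f h "- h'"] by (simp add: group_ring_mult_minus_right)

lemma group_ring_mult_sum_right:
  "f \<otimes>\<^bsub>group_ring G\<^esub> (\<Sum>x\<in>A. h x) = (\<Sum>x\<in>A. f \<otimes>\<^bsub>group_ring G\<^esub> h x)"
  by (induction A rule: infinite_finite_induct) (simp_all add: group_ring_mult_add_right)

lemma group_ring_mult_frag_of [simp]:
  "frag_of x \<otimes>\<^bsub>group_ring G\<^esub> frag_of y = frag_of (x \<otimes>\<^bsub>G\<^esub> y)"
  by (simp add: group_ring_mult)

lemma keys_group_ring_mult:
  assumes "group G" "Poly_Mapping.keys f \<subseteq> carrier G" "Poly_Mapping.keys h \<subseteq> carrier G"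
  shows "Poly_Mapping.keys (f \<otimes>\<^bsub>group_ring G\<^esub> h) \<subseteq> carrier G"
proof -
  interpret group G by fact
  have "Poly_Mapping.keys (frag_extend (\<lambda>y. frag_of (x \<otimes>\<^bsub>G\<^esub> y)) h) \<subseteq> carrier G" if "x \<in> carrier G" for x
    using keys_frag_extend[of "\<lambda>y. frag_of (x \<otimes>\<^bsub>G\<^esub> y)" h] assms(3) that by fastforce
  then show ?thesis
    unfolding group_ring_mult
    using keys_frag_extend[of "\<lambda>x. frag_extend (\<lambda>y. frag_of (x \<otimes>\<^bsub>G\<^esub> y)) h" f] assms(2) by blast
qed

text \<open>Both sides are additive in each argument, so nested inductions over generators and
  differences reduce the claim to associativity in \<open>G\<close>.\<close>

lemma group_ring_mult_assoc:
  assumes "group G" "Poly_Mapping.keys f \<subseteq> carrier G" "Poly_Mapping.keys g \<subseteq> carrier G"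
    "Poly_Mapping.keys h \<subseteq> carrier G"
  shows "f \<otimes>\<^bsub>group_ring G\<^esub> g \<otimes>\<^bsub>group_ring G\<^esub> h = f \<otimes>\<^bsub>group_ring G\<^esub> (g \<otimes>\<^bsub>group_ring G\<^esub> h)"
proof -
  interpret group G by fact
  show ?thesis
    using assms(2)
  proof (induction f rule: frag_induction)
    case (one x)
    show ?case
      using assms(3)
    proof (induction g rule: frag_induction)
      case (one y)
      show ?case
        using assms(4)
      proof (induction h rule: frag_induction)
        case (one z)
        then show ?case
          using \<open>x \<in> carrier G\<close> \<open>y \<in> carrier G\<close> by (simp add: m_assoc)
      qed (simp_all add: group_ring_mult_diff_right)
    qed (simp_all add: group_ring_mult_diff_left group_ring_mult_diff_right)
  qed (simp_all add: group_ring_mult_diff_left)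
qed

lemma group_ring_mult_commute:
  assumes "comm_group G" "Poly_Mapping.keys f \<subseteq> carrier G" "Poly_Mapping.keys g \<subseteq> carrier G"
  shows "f \<otimes>\<^bsub>group_ring G\<^esub> g = g \<otimes>\<^bsub>group_ring G\<^esub> f"
proof -
  interpret comm_group G by fact
  show ?thesis
    using assms(2)
  proof (induction f rule: frag_induction)
    case (one x)
    show ?case
      using assms(3)
    proof (induction g rule: frag_induction)
      case (one y)
      then show ?case using \<open>x \<in> carrier G\<close> by (simp add: m_comm)
    qed (simp_all add: group_ring_mult_diff_left group_ring_mult_diff_right)
  qed (simp_all add: group_ring_mult_diff_left group_ring_mult_diff_right)
qed

lemma group_ring_mult_one:
  assumes "group G" "Poly_Mapping.keys f \<subseteq> carrier G"
  shows "frag_of \<one>\<^bsub>G\<^esub> \<otimes>\<^bsub>group_ring G\<^esub> f = f"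
proof -
  interpret group G by fact
  show ?thesis
    using assms(2) by (induction f rule: frag_induction) (simp_all add: group_ring_mult_diff_right)
qed

lemma cring_group_ring:
  assumes "comm_group G"
  shows "cring (group_ring G)"
proof (rule cringI)
  interpret comm_group G by fact
  have add: "Poly_Mapping.keys (f + g) \<subseteq> carrier G"
    if "Poly_Mapping.keys f \<subseteq> carrier G" "Poly_Mapping.keys g \<subseteq> carrier G" for f g :: "'a \<Rightarrow>\<^sub>0 int"
    using that Poly_Mapping.keys_add[of f g] by blast
  show "abelian_group (group_ring G)"
  proof (rule abelian_groupI)
    show "\<exists>y\<in>carrier (group_ring G). y \<oplus>\<^bsub>group_ring G\<^esub> x = \<zero>\<^bsub>group_ring G\<^esub>"
      if "x \<in> carrier (group_ring G)" for x
      using that by (intro bexI[of _ "- x"]) auto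
  qed (auto simp: add add_ac subsetD[OF add])
  show "comm_monoid (group_ring G)"
    by (rule comm_monoidI)
      (simp_all add: keys_group_ring_mult group_ring_mult_assoc group_ring_mult_one is_group
        group_ring_mult_commute[OF assms])
  show "(x \<oplus>\<^bsub>group_ring G\<^esub> y) \<otimes>\<^bsub>group_ring G\<^esub> z
      = x \<otimes>\<^bsub>group_ring G\<^esub> z \<oplus>\<^bsub>group_ring G\<^esub> y \<otimes>\<^bsub>group_ring G\<^esub> z" for x y z
    by (simp add: group_ring_mult_add_left)
qed

lemma finsum_group_ring:
  assumes "comm_group G" "\<And>x. x \<in> A \<Longrightarrow> Poly_Mapping.keys (f x) \<subseteq> carrier G"
  shows "(\<Oplus>\<^bsub>group_ring G\<^esub>x\<in>A. f x) = (\<Sum>x\<in>A. f x)"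
proof -
  interpret cring "group_ring G" by (rule cring_group_ring) fact
  show ?thesis
    using assms(2)
    by (induction A rule: infinite_finite_induct) (auto simp: finsum_infinite)
qed

text \<open>Right multiplication by a group element translates coefficients; this is how the
  boundary coefficients become shifts of cyclic labels.\<close>

lemma lookup_group_ring_mult_frag_of:
  assumes "group G" "Poly_Mapping.keys f \<subseteq> carrier G" "x \<in> carrier G" "g \<in> carrier G"
  shows "Poly_Mapping.lookup (f \<otimes>\<^bsub>group_ring G\<^esub> frag_of x) g = Poly_Mapping.lookup f (g \<otimes>\<^bsub>G\<^esub> inv\<^bsub>G\<^esub> x)"
proof -
  interpret group G by fact
  show ?thesis
    using assms(2)
  proof (induction f rule: frag_induction)
    case (one y)
    then show ?case
      using assms(3,4) by (auto simp: m_assoc)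
  qed (simp_all add: group_ring_mult_diff_left lookup_minus)
qed

section \<open>The augmentation and the trivial module\<close>

lemma augmentation_superset:
  assumes "finite A" "Poly_Mapping.keys f \<subseteq> A"
  shows "augmentation f = (\<Sum>g\<in>A. Poly_Mapping.lookup f g)"
  unfolding augmentation_def using assms
  by (intro sum.mono_neutral_left) (auto simp: in_keys_iff)

lemma augmentation_add: "augmentation (f + h) = augmentation f + augmentation h"
proof -
  have "augmentation u = (\<Sum>g\<in>Poly_Mapping.keys f \<union> Poly_Mapping.keys h. Poly_Mapping.lookup u g)"
    if "u \<in> {f, h, f + h}" for u
    using that Poly_Mapping.keys_add[of f h] by (intro augmentation_superset) auto
  then show ?thesis by (simp add: lookup_add sum.distrib)
qed

lemma augmentation_simps [simp]: "augmentation 0 = 0" "augmentation (frag_of x) = 1"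
  by (simp_all add: augmentation_def)

lemma augmentation_diff: "augmentation (f - h) = augmentation f - augmentation h"
  using augmentation_add[of "f - h" h] by simp

lemma augmentation_sum: "augmentation (\<Sum>x\<in>A. f x) = (\<Sum>x\<in>A. augmentation (f x))"
  by (induction A rule: infinite_finite_induct) (simp_all add: augmentation_add)

lemma augmentation_cmul: "augmentation (frag_cmul c f) = c * augmentation f"
  using augmentation_superset[of "Poly_Mapping.keys f" "frag_cmul c f"]
  by (simp add: augmentation_def sum_distrib_left keys_cmul)

lemma augmentation_mult: "augmentation (f \<otimes>\<^bsub>group_ring G\<^esub> h) = augmentation f * augmentation h"
  by (simp add: group_ring_mult frag_extend_def augmentation_sum augmentation_cmul)
    (simp add: augmentation_def sum_distrib_right)

lemma module_trivial_module:
  assumes "comm_group G"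
  shows "Module.module (group_ring G) (trivial_module :: ('g \<Rightarrow>\<^sub>0 int, int) module)"
proof -
  \<comment> \<open>Scalars act through the augmentation, so the module axioms reduce to its being a
    ring homomorphism.\<close>
  have smult: "f \<odot>\<^bsub>trivial_module\<^esub> z = augmentation f * z" for f :: "'g \<Rightarrow>\<^sub>0 int" and z
    by (simp add: trivial_module_def augmentation_def sum_distrib_right)
  show ?thesis
  proof (rule moduleI)
    show "abelian_group (trivial_module :: ('g \<Rightarrow>\<^sub>0 int, int) module)"
      by (rule abelian_groupI) (auto simp: trivial_module_def intro: exI[of _ "- _"])
  qed (use assms in \<open>simp_all add: cring_group_ring smult augmentation_add augmentation_mult\<close>,
      simp_all add: trivial_module_def algebra_simps)
qed

section \<open>Homogeneous polynomials\<close>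

lemma (in cring) single_coeff_in_indexed_pset:
  assumes "set_mset m \<subseteq> I" "c \<in> carrier R"
  shows "(\<lambda>u. if u = m then c else \<zero>) \<in> (carrier R)[\<X>\<^bsub>I\<^esub>]"
  using assms(1)
proof (induction m)
  case empty
  show ?case
    using indexed_pset.indexed_const[OF assms(2), of I] by (simp add: indexed_const_def)
next
  case (add i m)
  have "(\<lambda>u. if u = add_mset i m then c else \<zero>) = indexed_pmult (\<lambda>u. if u = m then c else \<zero>) i"
    by (auto simp: indexed_pmult_def fun_eq_iff)
  then show ?case
    using add by (auto intro: indexed_pset.indexed_pmult)
qed

lemma (in cring) finite_support_in_indexed_pset:
  assumes "finite S" "\<And>m. p m \<in> carrier R" "\<And>m. m \<notin> S \<Longrightarrow> p m = \<zero>" "\<And>m. m \<in> S \<Longrightarrow> set_mset m \<subseteq> I"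
  shows "p \<in> (carrier R)[\<X>\<^bsub>I\<^esub>]"
  using assms
proof (induction S arbitrary: p)
  case empty
  then have "p = indexed_const \<zero>" by (simp add: indexed_const_def fun_eq_iff)
  then show ?case by (simp add: indexed_pset.indexed_const)
next
  case (insert m S)
  have "p = indexed_padd (p(m := \<zero>)) (\<lambda>u. if u = m then p m else \<zero>)"
    using insert.prems(1) by (auto simp: indexed_padd_def fun_eq_iff)
  moreover have "p(m := \<zero>) \<in> (carrier R)[\<X>\<^bsub>I\<^esub>]"
    using insert.prems by (intro insert.IH) auto
  moreover have "(\<lambda>u. if u = m then p m else \<zero>) \<in> (carrier R)[\<X>\<^bsub>I\<^esub>]"
    using insert.prems by (intro single_coeff_in_indexed_pset) auto
  ultimately show ?case by (metis indexed_pset.indexed_padd)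
qed

lemma (in cring) indexed_pset_support:
  assumes "p \<in> (carrier R)[\<X>\<^bsub>I\<^esub>]"
  shows "p m \<in> carrier R \<and> (p m \<noteq> \<zero> \<longrightarrow> set_mset m \<subseteq> I)"
  using assms
proof (induction arbitrary: m)
  case (indexed_padd P Q)
  then show ?case by (metis (no_types, lifting) a_closed indexed_padd_def r_zero zero_closed)
next
  case (indexed_pmult P i)
  show ?case
  proof (cases "i \<in># m")
    case True
    then have "set_mset m = insert i (set_mset (m - {#i#}))"
      by (metis insert_DiffM set_mset_add_mset_insert)
    then show ?thesis
      using indexed_pmult.IH[of "m - {#i#}"] indexed_pmult.hyps True by (simp add: indexed_pmult_def)
  qed (simp add: indexed_pmult_def)
qed (auto simp: indexed_const_def)

lemma finite_msets_of_size:
  assumes "finite I"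
  shows "finite {m. set_mset m \<subseteq> I \<and> size m = n}"
proof -
  have "{m. set_mset m \<subseteq> I \<and> size m = n} \<subseteq> mset ` {xs. set xs \<subseteq> I \<and> length xs = n}"
    by (metis (mono_tags, lifting) ex_mset image_eqI mem_Collect_eq set_mset_mset size_mset subsetI)
  then show ?thesis
    using finite_lists_length_eq[OF assms] finite_surj by blast
qed

text \<open>Over a finite variable set a fixed degree admits finitely many monomials. Finite support
  is then automatic, and membership in the inductively generated set becomes a pointwise
  condition.\<close>

lemma (in cring) homogeneous_polys_carrier_iff:
  assumes "finite I"
  shows "p \<in> carrier (homogeneous_polys R I n) \<longleftrightarrow>
    (\<forall>m. p m \<in> carrier R) \<and> (\<forall>m. p m \<noteq> \<zero> \<longrightarrow> set_mset m \<subseteq> I \<and> size m = n)"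
    (is "?L \<longleftrightarrow> ?R")
proof
  show ?R if ?L
    using that indexed_pset_support by (auto simp: homogeneous_polys_def)
  show ?L if ?R
  proof -
    have "p \<in> (carrier R)[\<X>\<^bsub>I\<^esub>]"
    proof (rule finite_support_in_indexed_pset[OF finite_msets_of_size[OF assms, of n]])
      show "p m = \<zero>" if "m \<notin> {m. set_mset m \<subseteq> I \<and> size m = n}" for m
        using \<open>?R\<close> that by blast
    qed (use that in simp_all)
    then show ?thesis using that by (simp add: homogeneous_polys_def)
  qed
qed

lemma (in cring) homogeneous_polys_simps:
  "\<zero>\<^bsub>homogeneous_polys R I n\<^esub> = (\<lambda>_. \<zero>)"
  "p \<oplus>\<^bsub>homogeneous_polys R I n\<^esub> p' = (\<lambda>m. p m \<oplus> p' m)"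
  "r \<odot>\<^bsub>homogeneous_polys R I n\<^esub> p = (\<lambda>m. r \<otimes> p m)"
  by (simp_all add: homogeneous_polys_def indexed_zero_def indexed_padd_def)

lemma (in cring) module_homogeneous_polys:
  assumes "finite I"
  shows "Module.module R (homogeneous_polys R I n)"
proof (rule moduleI)
  note iff = homogeneous_polys_carrier_iff[OF assms]
  note carr = iff[THEN iffD1, THEN conjunct1, rule_format]
  show "abelian_group (homogeneous_polys R I n)"
  proof (rule abelian_groupI)
    show "\<exists>y\<in>carrier (homogeneous_polys R I n). y \<oplus>\<^bsub>homogeneous_polys R I n\<^esub> x = \<zero>\<^bsub>homogeneous_polys R I n\<^esub>"
      if x: "x \<in> carrier (homogeneous_polys R I n)" for x
    proof
      show "(\<lambda>m. \<ominus> x m) \<in> carrier (homogeneous_polys R I n)"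
        using x unfolding iff by (metis a_inv_closed minus_zero)
      show "(\<lambda>m. \<ominus> x m) \<oplus>\<^bsub>homogeneous_polys R I n\<^esub> x = \<zero>\<^bsub>homogeneous_polys R I n\<^esub>"
        by (simp add: homogeneous_polys_simps l_neg carr[OF x])
    qed
    show "x \<oplus>\<^bsub>homogeneous_polys R I n\<^esub> y \<in> carrier (homogeneous_polys R I n)"
      if "x \<in> carrier (homogeneous_polys R I n)" "y \<in> carrier (homogeneous_polys R I n)" for x y
      using that unfolding iff homogeneous_polys_simps
      by (metis a_closed r_zero zero_closed)
    show "\<zero>\<^bsub>homogeneous_polys R I n\<^esub> \<in> carrier (homogeneous_polys R I n)"
      unfolding iff by (simp add: homogeneous_polys_simps)
    show "x \<oplus>\<^bsub>homogeneous_polys R I n\<^esub> y \<oplus>\<^bsub>homogeneous_polys R I n\<^esub> z = x \<oplus>\<^bsub>homogeneous_polys R I n\<^esub> (y \<oplus>\<^bsub>homogeneous_polys R I n\<^esub> z)"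
      if "x \<in> carrier (homogeneous_polys R I n)" "y \<in> carrier (homogeneous_polys R I n)"
        "z \<in> carrier (homogeneous_polys R I n)" for x y z
      by (simp add: homogeneous_polys_simps carr[OF that(1)] carr[OF that(2)] carr[OF that(3)] a_assoc)
    show "x \<oplus>\<^bsub>homogeneous_polys R I n\<^esub> y = y \<oplus>\<^bsub>homogeneous_polys R I n\<^esub> x"
      if "x \<in> carrier (homogeneous_polys R I n)" "y \<in> carrier (homogeneous_polys R I n)" for x y
      by (simp add: homogeneous_polys_simps carr[OF that(1)] carr[OF that(2)] a_comm)
    show "\<zero>\<^bsub>homogeneous_polys R I n\<^esub> \<oplus>\<^bsub>homogeneous_polys R I n\<^esub> x = x" if "x \<in> carrier (homogeneous_polys R I n)" for x
      by (simp add: homogeneous_polys_simps carr[OF that])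
  qed
  show "a \<odot>\<^bsub>homogeneous_polys R I n\<^esub> x \<in> carrier (homogeneous_polys R I n)"
    if "a \<in> carrier R" "x \<in> carrier (homogeneous_polys R I n)" for a x
    using that unfolding iff homogeneous_polys_simps by (metis m_closed r_null)
  show "cring R" by (rule is_cring)
  show "(a \<oplus> b) \<odot>\<^bsub>homogeneous_polys R I n\<^esub> x = a \<odot>\<^bsub>homogeneous_polys R I n\<^esub> x \<oplus>\<^bsub>homogeneous_polys R I n\<^esub> b \<odot>\<^bsub>homogeneous_polys R I n\<^esub> x"
    if "a \<in> carrier R" "b \<in> carrier R" "x \<in> carrier (homogeneous_polys R I n)" for a b x
    using that(1,2) by (simp add: homogeneous_polys_simps l_distr carr[OF that(3)])
  show "(a \<otimes> b) \<odot>\<^bsub>homogeneous_polys R I n\<^esub> x = a \<odot>\<^bsub>homogeneous_polys R I n\<^esub> (b \<odot>\<^bsub>homogeneous_polys R I n\<^esub> x)"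
    if "a \<in> carrier R" "b \<in> carrier R" "x \<in> carrier (homogeneous_polys R I n)" for a b x
    using that(1,2) by (simp add: homogeneous_polys_simps m_assoc carr[OF that(3)])
  show "a \<odot>\<^bsub>homogeneous_polys R I n\<^esub> (x \<oplus>\<^bsub>homogeneous_polys R I n\<^esub> y) = a \<odot>\<^bsub>homogeneous_polys R I n\<^esub> x \<oplus>\<^bsub>homogeneous_polys R I n\<^esub> a \<odot>\<^bsub>homogeneous_polys R I n\<^esub> y"
    if "a \<in> carrier R" "x \<in> carrier (homogeneous_polys R I n)" "y \<in> carrier (homogeneous_polys R I n)" for a x y
    using that(1) by (simp add: homogeneous_polys_simps r_distr carr[OF that(2)] carr[OF that(3)])
  show "\<one> \<odot>\<^bsub>homogeneous_polys R I n\<^esub> x = x" if "x \<in> carrier (homogeneous_polys R I n)" for x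
    by (simp add: homogeneous_polys_simps carr[OF that])
qed

lemma (in cring) finsum_homogeneous_polys:
  assumes "finite I" "finite A" "\<And>x. x \<in> A \<Longrightarrow> f x \<in> carrier (homogeneous_polys R I n)"
  shows "(\<Oplus>\<^bsub>homogeneous_polys R I n\<^esub>x\<in>A. f x) m = (\<Oplus>x\<in>A. f x m)"
proof -
  have M: "abelian_monoid (homogeneous_polys R I n)"
    using module_homogeneous_polys[OF assms(1)]
    by (simp add: Module.module_def abelian_group_def)
  show ?thesis
    using assms(2,3)
  proof (induction A)
    case (insert x A)
    have "f x m \<in> carrier R" "(\<lambda>x. f x m) \<in> A \<rightarrow> carrier R"
      using insert.prems unfolding homogeneous_polys_carrier_iff[OF assms(1)] by blast+
    moreover have "f x \<in> carrier (homogeneous_polys R I n)" "f \<in> A \<rightarrow> carrier (homogeneous_polys R I n)"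
      using insert.prems by blast+
    ultimately show ?case
      using insert by (simp add: abelian_monoid.finsum_insert[OF M] homogeneous_polys_simps(2))
  qed (simp add: abelian_monoid.finsum_empty[OF M] homogeneous_polys_simps)
qed

lemma (in cring) monomial_in_homogeneous_polys:
  assumes "finite I" "set_mset m \<subseteq> I" "size m = n"
  shows "monomial R m \<in> carrier (homogeneous_polys R I n)"
  using assms by (auto simp: homogeneous_polys_carrier_iff monomial_def)

text \<open>As \<open>\<one> \<noteq> \<zero>\<close>, distinct multisets give distinct monomials,
  so coefficients may be indexed by either.\<close>

lemma (in cring) basis_homogeneous_polys:
  assumes "finite I" "\<one> \<noteq> \<zero>"
  shows "is_basis R (homogeneous_polys R I n) (monomial R ` {m. set_mset m \<subseteq> I \<and> size m = n})"
    (is "is_basis R ?M ?B")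
proof -
  note smult_closed = Module.module.smult_closed[OF module_homogeneous_polys[OF assms(1)]]
  let ?S = "{m. set_mset m \<subseteq> I \<and> size m = n}"
  have inj: "monomial R m = monomial R m' \<longleftrightarrow> m = m'" for m m' :: "'c multiset"
    using assms(2) by (metis monomial_def)
  have carr: "b \<in> carrier ?M" if "b \<in> ?B" for b
    using that monomial_in_homogeneous_polys[OF assms(1)] by auto
  have fin: "finite ?B" using finite_msets_of_size[OF assms(1)] by simp
  \<comment> \<open>Evaluating a linear combination at \<open>m\<close> isolates one coefficient;
    this yields existence as well as uniqueness.\<close>
  have expand: "(\<Oplus>\<^bsub>?M\<^esub>b\<in>{b \<in> ?B. c b \<noteq> \<zero>}. c b \<odot>\<^bsub>?M\<^esub> b) m
      = (if m \<in> ?S then c (monomial R m) else \<zero>)"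
    if c: "c \<in> ?B \<rightarrow> carrier R" for c m
  proof -
    let ?C = "{b \<in> ?B. c b \<noteq> \<zero>}"
    have "(\<Oplus>\<^bsub>?M\<^esub>b\<in>?C. c b \<odot>\<^bsub>?M\<^esub> b) m = (\<Oplus>b\<in>?C. (c b \<odot>\<^bsub>?M\<^esub> b) m)"
      using fin c carr by (intro finsum_homogeneous_polys[OF assms(1)] smult_closed) auto
    also have "\<dots> = (\<Oplus>b\<in>?C. if monomial R m = b then c b else \<zero>)"
    proof (rule finsum_cong')
      show "(c b \<odot>\<^bsub>?M\<^esub> b) m = (if monomial R m = b then c b else \<zero>)" if "b \<in> ?C" for b
      proof -
        from that obtain m' where m': "b = monomial R m'" by auto
        have "c b \<in> carrier R" using that c by auto
        moreover have "b m = (if m = m' then \<one> else \<zero>)"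
          unfolding m' by (simp add: monomial_def)
        moreover have "monomial R m = b \<longleftrightarrow> m = m'"
          unfolding m' by (rule inj)
        ultimately show ?thesis by (simp add: homogeneous_polys_simps)
      qed
    qed (use c in auto)
    also have "\<dots> = (if m \<in> ?S then c (monomial R m) else \<zero>)"
    proof (cases "monomial R m \<in> ?C")
      case True
      moreover have "m \<in> ?S" using True inj by auto
      ultimately show ?thesis
        using fin c finsum_singleton[of "monomial R m" ?C c] by auto
    next
      case False
      then have "(\<Oplus>b\<in>?C. if monomial R m = b then c b else \<zero>) = (\<Oplus>b\<in>?C. \<zero>)"
        by (intro finsum_cong') auto
      then show ?thesis using False by auto
    qed
    finally show ?thesis .
  qed
  show ?thesis
    unfolding is_basis_def
  proof (intro conjI ballI)
    show "?B \<subseteq> carrier ?M" using carr by blast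
    fix x assume x: "x \<in> carrier ?M"
    note x' = x[unfolded homogeneous_polys_carrier_iff[OF assms(1)]]
    define c where "c = (\<lambda>b. if b \<in> ?B then x (the_inv_into ?S (monomial R) b) else \<zero>)"
    have injS: "inj_on (monomial R) ?S" by (simp add: inj_on_def inj)
    have cm: "c (monomial R m) = x m" if "m \<in> ?S" for m
      using that the_inv_into_f_f[OF injS that] by (auto simp: c_def)
    have c: "c \<in> ?B \<rightarrow> carrier R" using x' by (auto simp: c_def)
    show "\<exists>!c. c \<in> ?B \<rightarrow> carrier R \<and> (\<forall>b. b \<notin> ?B \<longrightarrow> c b = \<zero>) \<and> finite {b \<in> ?B. c b \<noteq> \<zero>} \<and>
        x = (\<Oplus>\<^bsub>?M\<^esub>b\<in>{b \<in> ?B. c b \<noteq> \<zero>}. c b \<odot>\<^bsub>?M\<^esub> b)"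
    proof (rule ex1I[of _ c], intro conjI)
      show "x = (\<Oplus>\<^bsub>?M\<^esub>b\<in>{b \<in> ?B. c b \<noteq> \<zero>}. c b \<odot>\<^bsub>?M\<^esub> b)"
      proof
        show "x m = (\<Oplus>\<^bsub>?M\<^esub>b\<in>{b \<in> ?B. c b \<noteq> \<zero>}. c b \<odot>\<^bsub>?M\<^esub> b) m" for m
          unfolding expand[OF c] using x' cm by auto
      qed
    next
      fix c' assume c': "c' \<in> ?B \<rightarrow> carrier R \<and> (\<forall>b. b \<notin> ?B \<longrightarrow> c' b = \<zero>) \<and> finite {b \<in> ?B. c' b \<noteq> \<zero>} \<and>
        x = (\<Oplus>\<^bsub>?M\<^esub>b\<in>{b \<in> ?B. c' b \<noteq> \<zero>}. c' b \<odot>\<^bsub>?M\<^esub> b)"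
      have "c' (monomial R m) = x m" if "m \<in> ?S" for m
        using expand[of c' m] c' that by (metis (mono_tags, lifting))
      then have "c' b = c b" if "b \<in> ?B" for b
        using that cm by auto
      moreover have "c' b = c b" if "b \<notin> ?B" for b
        using that c'[THEN conjunct2, THEN conjunct1] by (simp add: c_def)
      ultimately show "c' = c" by blast
    qed (use c fin in \<open>auto simp: c_def\<close>)
  qed
qed

lemma (in cring) free_module_homogeneous_polys:
  assumes "finite I" "\<one> \<noteq> \<zero>"
  shows "free_module R (homogeneous_polys R I n)"
  using module_homogeneous_polys[OF assms(1)] basis_homogeneous_polys[OF assms]
  unfolding free_module_def by blast

section \<open>Coordinates on the group ring of a product of cyclic groups\<close>

text \<open>Powers below \<open>ord a\<close> enumerate the subgroup generated by \<open>a\<close>,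
  here all of \<open>G\<close>; comparing cardinalities identifies \<open>ord a\<close> with the
  order of \<open>G\<close>.\<close>

lemma (in group) bij_betw_pow_generator:
  assumes "finite (carrier G)" "a \<in> carrier G" "carrier G = generate G {a}"
  shows "bij_betw (\<lambda>t::nat. a [^] t) {..<order G} (carrier G)"
proof -
  have eq: "{0..ord a - 1} = {..<ord a}"
    using ord_ge_1[OF assms(1,2)] by auto
  have "carrier G = (\<lambda>t::nat. a [^] t) ` {..<ord a}"
    using assms(3) generate_pow_on_finite_carrier[OF assms(1,2)] ord_elems[OF assms(1,2)]
    unfolding eq by auto
  moreover have "inj_on (\<lambda>t::nat. a [^] t) {..<ord a}"
    using ord_inj[OF assms(2)] unfolding eq .
  ultimately have bij: "bij_betw (\<lambda>t::nat. a [^] t) {..<ord a} (carrier G)"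
    by (simp add: bij_betw_def)
  then have "ord a = order G"
    using bij_betw_same_card[OF bij] by (simp add: order_def)
  then show ?thesis using bij by simp
qed

lemma add_mset_eq_iff_diff: "i \<in># m' \<Longrightarrow> m = m' - {#i#} \<longleftrightarrow> m' = add_mset i m"
  by (metis add_mset_remove_trivial insert_DiffM)

locale cyclic_factors =
  fixes s :: nat
    and G :: "nat \<Rightarrow> ('g, 'm) monoid_scheme"
    and a :: "nat \<Rightarrow> 'g"
    and q :: "nat \<Rightarrow> nat"
  assumes factor_group: "i \<in> {1..s} \<Longrightarrow> group (G i)"
    and generator_closed: "i \<in> {1..s} \<Longrightarrow> a i \<in> carrier (G i)"
    and generates: "i \<in> {1..s} \<Longrightarrow> carrier (G i) = generate (G i) {a i}"
    and finite_factor: "i \<in> {1..s} \<Longrightarrow> finite (carrier (G i))"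
    and factor_order: "i \<in> {1..s} \<Longrightarrow> order (G i) = q i"
begin

abbreviation "PG \<equiv> product_group {1..s} G"
abbreviation "ZG \<equiv> group_ring PG"

lemma bij_betw_pow: "i \<in> {1..s} \<Longrightarrow> bij_betw (\<lambda>t::nat. a i [^]\<^bsub>G i\<^esub> t) {..<q i} (carrier (G i))"
  using group.bij_betw_pow_generator[OF factor_group finite_factor generator_closed generates, of i]
    factor_order[of i] by simp

text \<open>The discrete logarithm to the base of the chosen generator.\<close>

definition dlog :: "nat \<Rightarrow> 'g \<Rightarrow> nat" where
  "dlog i = the_inv_into {..<q i} (\<lambda>t. a i [^]\<^bsub>G i\<^esub> t)"

lemma bij_betw_dlog: "i \<in> {1..s} \<Longrightarrow> bij_betw (dlog i) (carrier (G i)) {..<q i}"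
  unfolding dlog_def by (rule bij_betw_the_inv_into[OF bij_betw_pow])

lemma dlog_less: "i \<in> {1..s} \<Longrightarrow> x \<in> carrier (G i) \<Longrightarrow> dlog i x < q i"
  using bij_betw_dlog[of i] by (auto simp: bij_betw_def)

lemma pow_dlog: "i \<in> {1..s} \<Longrightarrow> x \<in> carrier (G i) \<Longrightarrow> a i [^]\<^bsub>G i\<^esub> dlog i x = x"
  unfolding dlog_def using bij_betw_pow[of i]
  by (metis bij_betw_def f_the_inv_into_f)

lemma dlog_pow: "i \<in> {1..s} \<Longrightarrow> t < q i \<Longrightarrow> dlog i (a i [^]\<^bsub>G i\<^esub> t) = t"
  unfolding dlog_def using bij_betw_pow[of i]
  by (auto simp: bij_betw_def intro: the_inv_into_f_f)

lemma dlog_mult_inv_generator: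
  assumes i: "i \<in> {1..s}" and x: "x \<in> carrier (G i)"
  shows "dlog i (x \<otimes>\<^bsub>G i\<^esub> inv\<^bsub>G i\<^esub> a i) = cyc_pred (q i) (dlog i x)"
proof -
  interpret G: group "G i" by (rule factor_group[OF i])
  note closed = generator_closed[OF i]
  have q: "dlog i x < q i" by (rule dlog_less[OF i x])
  have "a i [^]\<^bsub>G i\<^esub> cyc_pred (q i) (dlog i x) \<otimes>\<^bsub>G i\<^esub> a i = x"
  proof (cases "dlog i x")
    \<comment> \<open>For the identity the predecessor is \<open>q i - 1\<close>, and the
      wrap-around is the relation \<open>a^q = 1\<close>.\<close>
    case 0
    then have "x = \<one>\<^bsub>G i\<^esub>" using pow_dlog[OF i x] by simp
    moreover have "a i [^]\<^bsub>G i\<^esub> (q i - 1) \<otimes>\<^bsub>G i\<^esub> a i = a i [^]\<^bsub>G i\<^esub> q i"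
      using q by (cases "q i") auto
    ultimately show ?thesis
      using 0 G.pow_order_eq_1[OF closed] factor_order[OF i] by (simp add: cyc_pred_def)
  next
    case (Suc t)
    then show ?thesis using pow_dlog[OF i x] by (simp add: cyc_pred_def)
  qed
  then have "x \<otimes>\<^bsub>G i\<^esub> inv\<^bsub>G i\<^esub> a i = a i [^]\<^bsub>G i\<^esub> cyc_pred (q i) (dlog i x)"
    using x closed by (metis G.inv_solve_right' G.nat_pow_closed)
  moreover have "cyc_pred (q i) (dlog i x) < q i" using q by (auto simp: cyc_pred_def)
  ultimately show ?thesis using dlog_pow[OF i] by simp
qed

text \<open>The map from \<open>t\<close> to the logarithm is a composite of bijections, so
  multiplying by the norm element sums all coefficients.\<close>

lemma sum_dlog_mult_inv_pow:
  assumes i: "i \<in> {1..s}" and x: "x \<in> carrier (G i)"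
  shows "(\<Sum>t<q i. f (dlog i (x \<otimes>\<^bsub>G i\<^esub> inv\<^bsub>G i\<^esub> (a i [^]\<^bsub>G i\<^esub> t)))) = (\<Sum>u<q i. (f u :: int))"
proof -
  interpret G: group "G i" by (rule factor_group[OF i])
  have "bij_betw (\<lambda>y. x \<otimes>\<^bsub>G i\<^esub> inv\<^bsub>G i\<^esub> y) (carrier (G i)) (carrier (G i))"
    by (rule bij_betwI[where g = "\<lambda>y. inv\<^bsub>G i\<^esub> y \<otimes>\<^bsub>G i\<^esub> x"])
      (use x in \<open>auto simp: G.inv_mult_group G.m_assoc simp flip: G.m_assoc[of x]\<close>)
  then have "bij_betw (dlog i \<circ> ((\<lambda>y. x \<otimes>\<^bsub>G i\<^esub> inv\<^bsub>G i\<^esub> y) \<circ> (\<lambda>t. a i [^]\<^bsub>G i\<^esub> t))) {..<q i} {..<q i}"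
    by (intro bij_betw_trans[OF _ bij_betw_dlog[OF i]] bij_betw_trans[OF bij_betw_pow[OF i]])
  from sum.reindex_bij_betw[OF this, of f] show ?thesis by simp
qed

lemma group_PG: "group PG"
  by (intro product_group factor_group)

text \<open>Commutativity comes from the generators: all elements of one factor are powers of the
  same element.\<close>

lemma comm_group_PG: "comm_group PG"
proof (rule group.group_comm_groupI[OF group_PG])
  have comm: "x \<otimes>\<^bsub>G i\<^esub> y = y \<otimes>\<^bsub>G i\<^esub> x"
    if i: "i \<in> {1..s}" and x: "x \<in> carrier (G i)" and y: "y \<in> carrier (G i)" for i x y
  proof -
    interpret G: group "G i" by (rule factor_group[OF i])
    show ?thesis
      using pow_dlog[OF i x] pow_dlog[OF i y] G.nat_pow_mult[OF generator_closed[OF i]]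
      by (metis add.commute)
  qed
  show "x \<otimes>\<^bsub>PG\<^esub> y = y \<otimes>\<^bsub>PG\<^esub> x" if "x \<in> carrier PG" "y \<in> carrier PG" for x y
    using that by (auto simp: PiE_iff comm)
qed

lemma finite_PG: "finite (carrier PG)"
  using finite_PiE[of "{1..s}" "\<lambda>i. carrier (G i)"] finite_factor by simp

lemma cring_ZG: "cring ZG"
  by (rule cring_group_ring[OF comm_group_PG])

lemma product_embed_closed: "i \<in> {1..s} \<Longrightarrow> x \<in> carrier (G i) \<Longrightarrow> product_embed {1..s} G i x \<in> carrier PG"
  using group.is_monoid[OF factor_group] by (auto simp: product_embed_def PiE_iff intro!: monoid.one_closed)

lemma product_embed_pow:
  assumes "i \<in> {1..s}" "x \<in> carrier (G i)"
  shows "product_embed {1..s} G i x [^]\<^bsub>PG\<^esub> (t::nat) = product_embed {1..s} G i (x [^]\<^bsub>G i\<^esub> t)"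
proof (induction t)
  case 0
  show ?case by (auto simp: nat_pow_def product_embed_def fun_eq_iff)
next
  case (Suc t)
  have "\<one>\<^bsub>G j\<^esub> \<otimes>\<^bsub>G j\<^esub> \<one>\<^bsub>G j\<^esub> = \<one>\<^bsub>G j\<^esub>" if "j \<in> {1..s}" for j
    using group.is_monoid[OF factor_group[OF that]] by (simp add: monoid.l_one)
  then show ?case
    using Suc assms group.is_monoid[OF group_PG] group.is_monoid[OF factor_group[OF assms(1)]]
    by (auto simp: monoid.nat_pow_Suc product_embed_def fun_eq_iff)
qed

text \<open>The label of the basis element \<open>g x^m\<close>. Coordinates outside
  \<open>{1..s}\<close> get a fixed value, so that a label is determined by its proper
  coordinates.\<close>

definition code :: "nat multiset \<Rightarrow> (nat \<Rightarrow> 'g) \<Rightarrow> nat \<Rightarrow> nat \<times> nat" where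
  "code m g = (\<lambda>i. if i \<in> {1..s} then (count m i, dlog i (g i)) else (0, 0))"

lemma code_valid: "g \<in> carrier PG \<Longrightarrow> i \<in> {1..s} \<Longrightarrow> snd (code m g i) < q i"
  using dlog_less by (auto simp: code_def PiE_iff)

text \<open>Raising one exponent and translating within the same factor touches a single coordinate;
  this is the function update on which \<open>lift_op\<close> is built.\<close>

lemma code_shift:
  assumes i: "i \<in> {1..s}" and g: "g \<in> carrier PG" and x: "x \<in> carrier (G i)"
  shows "code (add_mset i m) (g \<otimes>\<^bsub>PG\<^esub> inv\<^bsub>PG\<^esub> product_embed {1..s} G i x)
    = (code m g)(i := (Suc (count m i), dlog i (g i \<otimes>\<^bsub>G i\<^esub> inv\<^bsub>G i\<^esub> x)))"
proof -
  have "inv\<^bsub>PG\<^esub> product_embed {1..s} G i x = (\<lambda>j\<in>{1..s}. inv\<^bsub>G j\<^esub> product_embed {1..s} G i x j)"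
    using product_embed_closed[OF i x] factor_group by (intro inv_product_group) auto
  moreover have "g j \<otimes>\<^bsub>G j\<^esub> inv\<^bsub>G j\<^esub> \<one>\<^bsub>G j\<^esub> = g j" if "j \<in> {1..s}" for j
  proof -
    interpret G: group "G j" by (rule factor_group[OF that])
    show ?thesis using g that by (auto simp: PiE_iff)
  qed
  ultimately show ?thesis
    using i by (auto simp: code_def product_embed_def fun_eq_iff)
qed

lemma inj_on_code: "inj_on (case_prod code) {(m, g). set_mset m \<subseteq> {1..s} \<and> g \<in> carrier PG}"
proof (rule inj_onI, clarify)
  fix m g m' g'
  assume m: "set_mset m \<subseteq> {1..s}" "set_mset m' \<subseteq> {1..s}" and g: "g \<in> carrier PG" "g' \<in> carrier PG"
    and eq: "code m g = code m' g'"
  have eq': "count m i = count m' i \<and> dlog i (g i) = dlog i (g' i)" if "i \<in> {1..s}" for i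
    using fun_cong[OF eq, of i] that by (simp add: code_def)
  have "count m i = count m' i" for i
  proof (cases "i \<in> {1..s}")
    case False
    then have "i \<notin># m" "i \<notin># m'" using m by blast+
    then show ?thesis by (simp add: not_in_iff)
  qed (use eq' in blast)
  moreover have "g = g'"
  proof (rule PiE_ext)
    show "g \<in> (\<Pi>\<^sub>E i\<in>{1..s}. carrier (G i))" "g' \<in> (\<Pi>\<^sub>E i\<in>{1..s}. carrier (G i))" using g by simp_all
    show "g i = g' i" if "i \<in> {1..s}" for i
    proof -
      have "g i \<in> carrier (G i)" "g' i \<in> carrier (G i)" using g that by (auto simp: PiE_iff)
      then show ?thesis using eq'[OF that] pow_dlog[OF that] by metis
    qed
  qed
  ultimately show "m = m' \<and> g = g'" by (simp add: multiset_eq_iff)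
qed

definition cells :: "nat \<Rightarrow> (nat \<Rightarrow> nat \<times> nat) set" where
  "cells n = {w. (\<forall>i\<in>{1..s}. snd (w i) < q i) \<and> (\<forall>i. i \<notin> {1..s} \<longrightarrow> w i = (0, 0))
    \<and> (\<Sum>i=1..s. fst (w i)) = n}"

lemma size_eq_sum_count: "set_mset m \<subseteq> {1..s} \<Longrightarrow> size m = (\<Sum>i=1..s. count m i)"
  unfolding size_multiset_overloaded_eq
  by (intro sum.mono_neutral_left) (auto simp: not_in_iff)

lemma cells_eq: "cells n = (\<lambda>(m, g). code m g) ` ({m. set_mset m \<subseteq> {1..s} \<and> size m = n} \<times> carrier PG)"
proof
  show "(\<lambda>(m, g). code m g) ` ({m. set_mset m \<subseteq> {1..s} \<and> size m = n} \<times> carrier PG) \<subseteq> cells n"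
    using code_valid by (auto simp: cells_def size_eq_sum_count) (auto simp: code_def)
  show "cells n \<subseteq> (\<lambda>(m, g). code m g) ` ({m. set_mset m \<subseteq> {1..s} \<and> size m = n} \<times> carrier PG)"
  proof
    fix w assume w: "w \<in> cells n"
    define m where "m = (\<Sum>i=1..s. replicate_mset (fst (w i)) i)"
    define g where "g = (\<lambda>i\<in>{1..s}. a i [^]\<^bsub>G i\<^esub> snd (w i))"
    have closed: "a i [^]\<^bsub>G i\<^esub> snd (w i) \<in> carrier (G i)" if "i \<in> {1..s}" for i
      using bij_betw_apply[OF bij_betw_pow[OF that], of "snd (w i)"] that w by (simp add: cells_def)
    have count: "count m i = (if i \<in> {1..s} then fst (w i) else 0)" for i
      unfolding m_def count_sum by simp
    then have m: "set_mset m \<subseteq> {1..s}"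
      by (metis count_eq_zero_iff subsetI)
    then have "size m = n" using w by (simp add: size_eq_sum_count count cells_def)
    moreover have "g \<in> carrier PG"
      using closed by (simp add: g_def)
    moreover have "w = code m g"
    proof
      show "w i = code m g i" for i
        using w count dlog_pow by (auto simp: code_def g_def cells_def prod_eq_iff)
    qed
    ultimately show "w \<in> (\<lambda>(m, g). code m g) ` ({m. set_mset m \<subseteq> {1..s} \<and> size m = n} \<times> carrier PG)"
      using m by auto
  qed
qed

section \<open>The boundary of the polynomial complex\<close>

definition bd_coeff :: "nat \<Rightarrow> nat multiset \<Rightarrow> (nat \<Rightarrow> 'g) \<Rightarrow>\<^sub>0 int" where
  "bd_coeff i m = frag_cmul ((-1) ^ (\<Sum>j=1..<i. count m j))
     (boundary_coeff PG (product_embed {1..s} G i (a i)) (q i) (count m i))"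

lemma keys_bd_coeff:
  assumes "i \<in> {1..s}"
  shows "Poly_Mapping.keys (bd_coeff i m) \<subseteq> carrier PG"
proof -
  interpret PG: group PG by (rule group_PG)
  have e: "product_embed {1..s} G i (a i) \<in> carrier PG"
    by (rule product_embed_closed[OF assms generator_closed[OF assms]])
  have "Poly_Mapping.keys (boundary_coeff PG (product_embed {1..s} G i (a i)) (q i) (count m i)) \<subseteq> carrier PG"
    unfolding boundary_coeff_def
    using keys_diff[of "frag_of (product_embed {1..s} G i (a i))" "frag_of \<one>\<^bsub>PG\<^esub>"] e PG.one_closed
      sum_closed_free_Abelian_group[of "{..<q i}" "\<lambda>t. frag_of (product_embed {1..s} G i (a i) [^]\<^bsub>PG\<^esub> t)" "carrier PG"]
      PG.nat_pow_closed[OF e]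
    by (auto simp del: carrier_product_group one_product_group)
  then show ?thesis unfolding bd_coeff_def using keys_cmul by blast
qed

lemma bd_coeff_eq_0: "i \<notin># m \<Longrightarrow> bd_coeff i m = 0"
  by (simp add: bd_coeff_def boundary_coeff_def not_in_iff)

section \<open>Coefficientwise arithmetic and the boundary as a linear map\<close>

lemma PP_carrier_iff:
  "p \<in> carrier (PP s G n) \<longleftrightarrow>
    (\<forall>m. Poly_Mapping.keys (p m) \<subseteq> carrier PG) \<and> (\<forall>m. p m \<noteq> 0 \<longrightarrow> set_mset m \<subseteq> {1..s} \<and> size m = n)"
  using cring.homogeneous_polys_carrier_iff[OF cring_ZG, of "{1..s}" p n]
  by (simp add: PP_def cyclic_product_ring_def del: carrier_product_group)

lemma PP_simps:
  "\<zero>\<^bsub>PP s G n\<^esub> = (\<lambda>_. 0)"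
  "p \<oplus>\<^bsub>PP s G n\<^esub> p' = (\<lambda>m. p m + p' m)"
  "r \<odot>\<^bsub>PP s G n\<^esub> p = (\<lambda>m. r \<otimes>\<^bsub>ZG\<^esub> p m)"
  using cring.homogeneous_polys_simps[OF cring_ZG, where I = "{1..s}" and n = n]
  by (simp_all add: PP_def cyclic_product_ring_def)

lemma finsum_PP:
  assumes "finite A" "\<And>x. x \<in> A \<Longrightarrow> f x \<in> carrier (PP s G n)"
  shows "(\<Oplus>\<^bsub>PP s G n\<^esub>x\<in>A. f x) m = (\<Sum>x\<in>A. f x m)"
proof -
  have "(\<Oplus>\<^bsub>PP s G n\<^esub>x\<in>A. f x) m = (\<Oplus>\<^bsub>ZG\<^esub>x\<in>A. f x m)"
    using cring.finsum_homogeneous_polys[OF cring_ZG, of "{1..s}" A f n m] assms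
    by (simp add: PP_def cyclic_product_ring_def)
  also have "\<dots> = (\<Sum>x\<in>A. f x m)"
    using assms(2) by (intro finsum_group_ring[OF comm_group_PG]) (simp add: PP_carrier_iff)
  finally show ?thesis .
qed

lemma smult_closed_PP:
  assumes "Poly_Mapping.keys r \<subseteq> carrier PG" "p \<in> carrier (PP s G n)"
  shows "r \<odot>\<^bsub>PP s G n\<^esub> p \<in> carrier (PP s G n)"
  using assms keys_group_ring_mult[OF group_PG assms(1)] unfolding PP_carrier_iff PP_simps
  by (metis group_ring_mult_zero(2))

lemma sum_closed_PP:
  assumes "finite A" "\<And>x. x \<in> A \<Longrightarrow> f x \<in> carrier (PP s G n)"
  shows "(\<lambda>m. \<Sum>x\<in>A. f x m) \<in> carrier (PP s G n)"
  unfolding PP_carrier_iff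
proof (intro conjI allI impI)
  fix m
  have *: "Poly_Mapping.keys (f x m) \<subseteq> carrier PG" if "x \<in> A" for x
    using assms(2)[OF that] unfolding PP_carrier_iff by blast
  show "Poly_Mapping.keys (\<Sum>x\<in>A. f x m) \<subseteq> carrier PG"
    using sum_closed_free_Abelian_group[of A "\<lambda>x. f x m" "carrier PG"] * by simp
  assume "(\<Sum>x\<in>A. f x m) \<noteq> 0"
  then obtain x where "x \<in> A" "f x m \<noteq> 0" by (metis sum.neutral)
  then show "set_mset m \<subseteq> {1..s}" "size m = n"
    using assms(2)[of x] unfolding PP_carrier_iff by blast+
qed

lemma finite_support_PP:
  assumes "p \<in> carrier (PP s G n)"
  shows "finite {m. p m \<noteq> 0}"
  using assms unfolding PP_carrier_iff
  by (intro finite_subset[OF _ finite_msets_of_size[of "{1..s}" n]]) auto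

lemma bd_coeff_monomial_closed:
  assumes "i \<in> {1..s}" "set_mset m \<subseteq> {1..s}" "size m = n"
  shows "bd_coeff i m \<odot>\<^bsub>PP s G (n - 1)\<^esub> monomial ZG (m - {#i#}) \<in> carrier (PP s G (n - 1))"
proof (cases "i \<in># m")
  case True
  have "monomial ZG (m - {#i#}) \<in> carrier (PP s G (n - 1))"
    using assms True cring.monomial_in_homogeneous_polys[OF cring_ZG, of "{1..s}" "m - {#i#}" "n - 1"]
    by (auto simp: PP_def cyclic_product_ring_def size_Diff_singleton dest: in_diffD)
  then show ?thesis using smult_closed_PP keys_bd_coeff[OF assms(1)] by blast
next
  case False
  then show ?thesis by (simp add: bd_coeff_eq_0 PP_simps PP_carrier_iff)
qed

lemma boundary_monomial_closed:
  assumes "set_mset m \<subseteq> {1..s}" "size m = n"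
  shows "boundary_monomial s G a q n m \<in> carrier (PP s G (n - 1))"
    and "boundary_monomial s G a q n m u = (\<Sum>i=1..s. bd_coeff i m \<otimes>\<^bsub>ZG\<^esub> monomial ZG (m - {#i#}) u)"
proof -
  have eq: "boundary_monomial s G a q n m
      = (\<lambda>u. \<Sum>i=1..s. (bd_coeff i m \<odot>\<^bsub>PP s G (n - 1)\<^esub> monomial ZG (m - {#i#})) u)"
    unfolding boundary_monomial_def bd_coeff_def[symmetric]
    using bd_coeff_monomial_closed[OF _ assms]
    by (intro ext, subst finsum_PP) (simp_all add: cyclic_product_ring_def)
  show "boundary_monomial s G a q n m \<in> carrier (PP s G (n - 1))"
    unfolding eq using bd_coeff_monomial_closed[OF _ assms] by (intro sum_closed_PP) auto
  show "boundary_monomial s G a q n m u = (\<Sum>i=1..s. bd_coeff i m \<otimes>\<^bsub>ZG\<^esub> monomial ZG (m - {#i#}) u)"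
    unfolding eq by (simp add: PP_simps)
qed

text \<open>The definition distributes the image of each monomial. This dual form collects at
  \<open>m\<close> what arrives from the monomials \<open>x_i m\<close>, as \<open>cyc_bd\<close>
  does for labels. With the coefficient of \<open>p\<close> on the left, compatibility with scalars
  becomes associativity.\<close>

lemma boundary_apply:
  assumes p: "p \<in> carrier (PP s G n)"
  shows "boundary s G a q n p m = (\<Sum>i=1..s. p (add_mset i m) \<otimes>\<^bsub>ZG\<^esub> bd_coeff i (add_mset i m))"
    and "boundary s G a q n p \<in> carrier (PP s G (n - 1))"
proof -
  let ?S = "{m. p m \<noteq> 0}"
  note fin = finite_support_PP[OF p]
  have closed: "p m' \<odot>\<^bsub>PP s G (n - 1)\<^esub> boundary_monomial s G a q n m' \<in> carrier (PP s G (n - 1))"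
    if "m' \<in> ?S" for m'
  proof (rule smult_closed_PP)
    show "Poly_Mapping.keys (p m') \<subseteq> carrier PG" using p unfolding PP_carrier_iff by blast
    show "boundary_monomial s G a q n m' \<in> carrier (PP s G (n - 1))"
      using that p[unfolded PP_carrier_iff] by (intro boundary_monomial_closed(1)) blast+
  qed
  have eq: "boundary s G a q n p
      = (\<lambda>m. \<Sum>m'\<in>?S. (p m' \<odot>\<^bsub>PP s G (n - 1)\<^esub> boundary_monomial s G a q n m') m)"
    unfolding boundary_def using closed
    by (intro ext, simp only: cyclic_product_ring_def group_ring_simps, subst finsum_PP[OF fin]) auto
  show "boundary s G a q n p \<in> carrier (PP s G (n - 1))"
    unfolding eq using fin closed by (rule sum_closed_PP)
  have "boundary s G a q n p m = (\<Sum>m'\<in>?S. \<Sum>i=1..s. p m' \<otimes>\<^bsub>ZG\<^esub> (bd_coeff i m' \<otimes>\<^bsub>ZG\<^esub> monomial ZG (m' - {#i#}) m))"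
    unfolding eq PP_simps
  proof (rule sum.cong[OF refl])
    fix m' assume "m' \<in> ?S"
    then have "set_mset m' \<subseteq> {1..s}" "size m' = n" using p unfolding PP_carrier_iff by blast+
    then show "p m' \<otimes>\<^bsub>ZG\<^esub> boundary_monomial s G a q n m' m
        = (\<Sum>i=1..s. p m' \<otimes>\<^bsub>ZG\<^esub> (bd_coeff i m' \<otimes>\<^bsub>ZG\<^esub> monomial ZG (m' - {#i#}) m))"
      by (simp only: boundary_monomial_closed(2) group_ring_mult_sum_right)
  qed
  also have "\<dots> = (\<Sum>i=1..s. \<Sum>m'\<in>?S. p m' \<otimes>\<^bsub>ZG\<^esub> (bd_coeff i m' \<otimes>\<^bsub>ZG\<^esub> monomial ZG (m' - {#i#}) m))"
    by (rule sum.swap)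
  also have "\<dots> = (\<Sum>i=1..s. \<Sum>m'\<in>?S. if m' = add_mset i m then p m' \<otimes>\<^bsub>ZG\<^esub> bd_coeff i m' else 0)"
  proof (intro sum.cong refl)
    fix i m' assume i: "i \<in> {1..s}"
    show "p m' \<otimes>\<^bsub>ZG\<^esub> (bd_coeff i m' \<otimes>\<^bsub>ZG\<^esub> monomial ZG (m' - {#i#}) m)
        = (if m' = add_mset i m then p m' \<otimes>\<^bsub>ZG\<^esub> bd_coeff i m' else 0)"
    proof (cases "i \<in># m'")
      case True
      have "bd_coeff i m' \<otimes>\<^bsub>ZG\<^esub> frag_of \<one>\<^bsub>PG\<^esub> = bd_coeff i m'"
        using keys_bd_coeff[OF i] group_ring_mult_one[OF group_PG] group_ring_mult_commute[OF comm_group_PG]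
          monoid.one_closed[OF group.is_monoid[OF group_PG]]
        by (metis keys_frag_of empty_subsetI insert_subset)
      then show ?thesis
        using add_mset_eq_iff_diff[OF True, of m] by (cases "m' = add_mset i m") (simp_all add: monomial_def)
    next
      \<comment> \<open>The truncated \<open>m' - {#i#}\<close> is now \<open>m'\<close> itself and
        may coincide with \<open>m\<close>, but the coefficient in front is zero.\<close>
      case False
      then have "m' \<noteq> add_mset i m" by auto
      then show ?thesis using False by (simp add: bd_coeff_eq_0)
    qed
  qed
  also have "\<dots> = (\<Sum>i=1..s. p (add_mset i m) \<otimes>\<^bsub>ZG\<^esub> bd_coeff i (add_mset i m))"
    using fin by (intro sum.cong refl) (simp add: sum.delta)
  finally show "boundary s G a q n p m = (\<Sum>i=1..s. p (add_mset i m) \<otimes>\<^bsub>ZG\<^esub> bd_coeff i (add_mset i m))" .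
qed

lemma boundary_hom: "boundary s G a q n \<in> module_hom ZG (PP s G n) (PP s G (n - 1))"
  unfolding module_hom_def
proof (intro CollectI conjI ballI)
  show "boundary s G a q n \<in> carrier (PP s G n) \<rightarrow> carrier (PP s G (n - 1))"
    using boundary_apply(2) by blast
  have M: "Module.module ZG (PP s G n)"
    using cring.module_homogeneous_polys[OF cring_ZG, of "{1..s}" n]
    by (simp add: PP_def cyclic_product_ring_def)
  fix p assume p: "p \<in> carrier (PP s G n)"
  show "boundary s G a q n (p \<oplus>\<^bsub>PP s G n\<^esub> p') = boundary s G a q n p \<oplus>\<^bsub>PP s G (n - 1)\<^esub> boundary s G a q n p'"
    if p': "p' \<in> carrier (PP s G n)" for p'
  proof
    have "p \<oplus>\<^bsub>PP s G n\<^esub> p' \<in> carrier (PP s G n)"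
      using M p p' by (meson Module.module_def abelian_groupE(1))
    then show "boundary s G a q n (p \<oplus>\<^bsub>PP s G n\<^esub> p') m
        = (boundary s G a q n p \<oplus>\<^bsub>PP s G (n - 1)\<^esub> boundary s G a q n p') m" for m
      by (simp add: boundary_apply p p' PP_simps group_ring_mult_add_left sum.distrib)
  qed
  show "boundary s G a q n (r \<odot>\<^bsub>PP s G n\<^esub> p) = r \<odot>\<^bsub>PP s G (n - 1)\<^esub> boundary s G a q n p"
    if "r \<in> carrier ZG" for r
  proof
    fix m
    have r: "Poly_Mapping.keys r \<subseteq> carrier PG" using that by simp
    have "boundary s G a q n (r \<odot>\<^bsub>PP s G n\<^esub> p) m
        = (\<Sum>i=1..s. r \<otimes>\<^bsub>ZG\<^esub> p (add_mset i m) \<otimes>\<^bsub>ZG\<^esub> bd_coeff i (add_mset i m))"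
      by (subst boundary_apply(1)[OF smult_closed_PP[OF r p]]) (simp add: PP_simps)
    also have "\<dots> = (\<Sum>i=1..s. r \<otimes>\<^bsub>ZG\<^esub> (p (add_mset i m) \<otimes>\<^bsub>ZG\<^esub> bd_coeff i (add_mset i m)))"
      using p keys_bd_coeff by (intro sum.cong refl group_ring_mult_assoc[OF group_PG r]) (auto simp: PP_carrier_iff)
    finally show "boundary s G a q n (r \<odot>\<^bsub>PP s G n\<^esub> p) m = (r \<odot>\<^bsub>PP s G (n - 1)\<^esub> boundary s G a q n p) m"
      by (simp add: boundary_apply p PP_simps group_ring_mult_sum_right)
  qed
qed

text \<open>In degree one the variable removed has exponent \<open>1\<close>, so only the elements
  \<open>a_i - 1\<close> arise, and the augmentation kills them.\<close>

lemma augmentation_boundary: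
  assumes "p \<in> carrier (PP s G 1)"
  shows "augmentation (boundary s G a q 1 p {#}) = 0"
  unfolding boundary_apply(1)[OF assms] augmentation_sum augmentation_mult bd_coeff_def augmentation_cmul
  by (simp add: boundary_coeff_def augmentation_diff)

section \<open>Polynomials as chains\<close>

text \<open>A map onto the homogeneous polynomials that reads \<open>F\<close> on
  \<open>cells n\<close> only; it links unrestricted functions with polynomials.\<close>

definition chain_poly :: "nat \<Rightarrow> chain \<Rightarrow> nat multiset \<Rightarrow> (nat \<Rightarrow> 'g) \<Rightarrow>\<^sub>0 int" where
  "chain_poly n F m = (if set_mset m \<subseteq> {1..s} \<and> size m = n
     then \<Sum>g\<in>carrier PG. frag_cmul (F (code m g)) (frag_of g) else 0)"

lemma lookup_chain_poly:
  "Poly_Mapping.lookup (chain_poly n F m) g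
    = (if set_mset m \<subseteq> {1..s} \<and> size m = n \<and> g \<in> carrier PG then F (code m g) else 0)"
proof (cases "set_mset m \<subseteq> {1..s} \<and> size m = n")
  case True
  then have "Poly_Mapping.lookup (chain_poly n F m) g
      = (\<Sum>h\<in>carrier PG. if h = g then F (code m h) else 0)"
    unfolding chain_poly_def by (simp add: lookup_sum del: carrier_product_group) (rule sum.cong, auto)
  then show ?thesis using True finite_PG by (simp add: sum.delta del: carrier_product_group)
qed (auto simp: chain_poly_def)

lemma keys_chain_poly: "Poly_Mapping.keys (chain_poly n F m) \<subseteq> carrier PG"
  by (metis in_keys_iff lookup_chain_poly subsetI)

lemma chain_poly_closed: "chain_poly n F \<in> carrier (PP s G n)"
  unfolding PP_carrier_iff using keys_chain_poly by (auto simp: chain_poly_def)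

lemma chain_poly_eq_iff: "chain_poly n F = chain_poly n F' \<longleftrightarrow> (\<forall>w\<in>cells n. F w = F' w)"
proof
  show "chain_poly n F = chain_poly n F'" if "\<forall>w\<in>cells n. F w = F' w"
    by (intro ext poly_mapping_eqI)
      (use that in \<open>auto simp: lookup_chain_poly cells_eq simp del: carrier_product_group\<close>)
  show "\<forall>w\<in>cells n. F w = F' w" if eq: "chain_poly n F = chain_poly n F'"
  proof
    fix w assume "w \<in> cells n"
    then obtain m g where m: "set_mset m \<subseteq> {1..s}" "size m = n" and g: "g \<in> carrier PG" and w: "w = code m g"
      unfolding cells_eq by auto
    show "F w = F' w"
      using arg_cong[OF fun_cong[OF eq, of m], of "\<lambda>r. Poly_Mapping.lookup r g"] m g w
      by (simp add: lookup_chain_poly del: carrier_product_group)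
  qed
qed

lemma chain_poly_zero: "chain_poly n 0 = (\<lambda>_. 0)"
  by (intro ext) (simp add: chain_poly_def)

text \<open>The representative is extended by zero off \<open>cells n\<close>, so that a cycle has
  zero boundary as a function and not merely on the labels of one degree; the homotopy identity
  needs the former.\<close>

lemma chain_poly_surj:
  assumes p: "p \<in> carrier (PP s G n)"
  obtains F where "p = chain_poly n F" "\<And>w. w \<notin> cells n \<Longrightarrow> F w = 0"
proof
  let ?V = "{(m, g). set_mset m \<subseteq> {1..s} \<and> g \<in> carrier PG}"
  let ?F = "\<lambda>w. if w \<in> cells n then case the_inv_into ?V (case_prod code) w of (m, g) \<Rightarrow> Poly_Mapping.lookup (p m) g else 0"
  have F: "?F (code m g) = Poly_Mapping.lookup (p m) g"
    if "set_mset m \<subseteq> {1..s}" "size m = n" "g \<in> carrier PG" for m g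
  proof -
    have "(case_prod code) (m, g) \<in> cells n" unfolding cells_eq using that by auto
    moreover have "the_inv_into ?V (case_prod code) ((case_prod code) (m, g)) = (m, g)"
      using that by (intro the_inv_into_f_f[OF inj_on_code]) auto
    ultimately show ?thesis by simp
  qed
  show "p = chain_poly n ?F"
  proof (intro ext poly_mapping_eqI)
    fix m g
    show "Poly_Mapping.lookup (p m) g = Poly_Mapping.lookup (chain_poly n ?F m) g"
    proof (cases "set_mset m \<subseteq> {1..s} \<and> size m = n \<and> g \<in> carrier PG")
      case True
      then show ?thesis unfolding lookup_chain_poly using F by presburger
    next
      case False
      have "p m = 0 \<or> g \<notin> Poly_Mapping.keys (p m)"
        using False p unfolding PP_carrier_iff by blast
      then show ?thesis unfolding lookup_chain_poly using False by (auto simp: in_keys_iff)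
    qed
  qed
  show "?F w = 0" if "w \<notin> cells n" for w using that by simp
qed

text \<open>The comparison of the two complexes in one direction \<open>i\<close>: an odd exponent
  gives a difference of two translates, an even one the sum over all of them, and logarithms turn
  these into the terms of \<open>cyc_bd\<close>. The parities look reversed because the exponent is
  one more than the degree in the label \<open>code m g i\<close>.\<close>

lemma lookup_mult_bd_coeff:
  assumes i: "i \<in> {1..s}" and m: "set_mset m \<subseteq> {1..s}" "Suc (size m) = n" and g: "g \<in> carrier PG"
  shows "Poly_Mapping.lookup (chain_poly n F (add_mset i m) \<otimes>\<^bsub>ZG\<^esub> bd_coeff i (add_mset i m)) g
    = (-1) ^ (\<Sum>j=1..<i. fst (code m g j)) * cyc_bd (q i) (\<lambda>y. F ((code m g)(i := y))) (code m g i)"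
proof -
  interpret PG: group PG by (rule group_PG)
  interpret Gi: group "G i" by (rule factor_group[OF i])
  let ?p = "chain_poly n F (add_mset i m)" and ?w = "code m g" and ?k = "count m i"
  have gi: "g i \<in> carrier (G i)" using g i by auto
  have lookup: "Poly_Mapping.lookup (?p \<otimes>\<^bsub>ZG\<^esub> frag_of (product_embed {1..s} G i x)) g
      = F (?w(i := (Suc ?k, dlog i (g i \<otimes>\<^bsub>G i\<^esub> inv\<^bsub>G i\<^esub> x))))"
    if x: "x \<in> carrier (G i)" for x
  proof -
    note e = product_embed_closed[OF i x]
    have "g \<otimes>\<^bsub>PG\<^esub> inv\<^bsub>PG\<^esub> product_embed {1..s} G i x \<in> carrier PG"
      by (intro PG.m_closed PG.inv_closed g e)
    then show ?thesis
      unfolding lookup_group_ring_mult_frag_of[OF group_PG keys_chain_poly e g] lookup_chain_poly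
        code_shift[OF i g x]
      using i m by simp
  qed
  have wi: "?w i = (?k, dlog i (g i))" using i by (simp add: code_def)
  have less: "dlog i (g i) < q i" by (rule dlog_less[OF i gi])
  have "Poly_Mapping.lookup (?p \<otimes>\<^bsub>ZG\<^esub> boundary_coeff PG (product_embed {1..s} G i (a i)) (q i) (Suc ?k)) g
      = cyc_bd (q i) (\<lambda>y. F (?w(i := y))) (?w i)"
  proof (cases "even ?k")
    case True
    \<comment> \<open>Writing the identity as an embedded element lets one translation rule treat
      both terms of \<open>a_i - 1\<close>.\<close>
    have one: "\<one>\<^bsub>PG\<^esub> = product_embed {1..s} G i \<one>\<^bsub>G i\<^esub>"
      by (auto simp: product_embed_def fun_eq_iff)
    have "Poly_Mapping.lookup (?p \<otimes>\<^bsub>ZG\<^esub> boundary_coeff PG (product_embed {1..s} G i (a i)) (q i) (Suc ?k)) g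
        = F (?w(i := (Suc ?k, cyc_pred (q i) (dlog i (g i))))) - F (?w(i := (Suc ?k, dlog i (g i))))"
      using True gi lookup[OF generator_closed[OF i]] lookup[OF Gi.one_closed]
      unfolding boundary_coeff_def one
      by (simp add: group_ring_mult_diff_right lookup_minus dlog_mult_inv_generator[OF i gi])
    then show ?thesis using True less unfolding wi by (simp add: cyc_bd_def)
  next
    case False
    have "Poly_Mapping.lookup (?p \<otimes>\<^bsub>ZG\<^esub> boundary_coeff PG (product_embed {1..s} G i (a i)) (q i) (Suc ?k)) g
        = (\<Sum>t<q i. Poly_Mapping.lookup (?p \<otimes>\<^bsub>ZG\<^esub> frag_of (product_embed {1..s} G i (a i [^]\<^bsub>G i\<^esub> t))) g)"
      using False
      by (simp only: boundary_coeff_def group_ring_mult_sum_right lookup_sum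
          product_embed_pow[OF i generator_closed[OF i]] nat.distinct even_Suc if_False simp_thms)
    also have "\<dots> = (\<Sum>t<q i. F (?w(i := (Suc ?k, dlog i (g i \<otimes>\<^bsub>G i\<^esub> inv\<^bsub>G i\<^esub> (a i [^]\<^bsub>G i\<^esub> t))))))"
      by (intro sum.cong refl lookup Gi.nat_pow_closed generator_closed[OF i])
    also have "\<dots> = (\<Sum>u<q i. F (?w(i := (Suc ?k, u))))"
      by (rule sum_dlog_mult_inv_pow[OF i gi])
    finally show ?thesis using False less unfolding wi by (simp add: cyc_bd_def)
  qed
  moreover have "(\<Sum>j=1..<i. count (add_mset i m) j) = (\<Sum>j=1..<i. fst (?w j))"
    using i by (intro sum.cong) (auto simp: code_def)
  ultimately show ?thesis
    unfolding bd_coeff_def by (simp add: group_ring_mult_cmul)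
qed

lemma boundary_chain_poly:
  assumes "0 < n"
  shows "boundary s G a q n (chain_poly n F) = chain_poly (n - 1) (tot_bd q s F)"
proof (intro ext poly_mapping_eqI)
  fix m g
  note bd = boundary_apply[OF chain_poly_closed[of n F]]
  show "Poly_Mapping.lookup (boundary s G a q n (chain_poly n F) m) g
      = Poly_Mapping.lookup (chain_poly (n - 1) (tot_bd q s F) m) g"
  proof (cases "set_mset m \<subseteq> {1..s} \<and> size m = n - 1 \<and> g \<in> carrier PG")
    case True
    then have m: "set_mset m \<subseteq> {1..s}" "Suc (size m) = n" and g: "g \<in> carrier PG" using assms by auto
    have "Poly_Mapping.lookup (boundary s G a q n (chain_poly n F) m) g = tot_bd q s F (code m g)"
      unfolding bd(1) lookup_sum
      by (subst tot_bd_apply) (blast intro: code_valid[OF g], intro sum.cong refl lookup_mult_bd_coeff m g)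
    then show ?thesis using True unfolding lookup_chain_poly by simp
  next
    case False
    have "boundary s G a q n (chain_poly n F) m = 0
        \<or> g \<notin> Poly_Mapping.keys (boundary s G a q n (chain_poly n F) m)"
      using False bd(2) unfolding PP_carrier_iff by blast
    then show ?thesis unfolding lookup_chain_poly using False by (auto simp: in_keys_iff)
  qed
qed

text \<open>Upgrades vanishing on \<open>cells (n - 1)\<close> to vanishing everywhere, as the
  homotopy requires; for \<open>n = 0\<close> it forces the boundary to be zero.\<close>

lemma tot_bd_support:
  assumes F: "\<And>w. w \<notin> cells n \<Longrightarrow> F w = 0" and "tot_bd q s F w \<noteq> 0"
  shows "0 < n \<and> w \<in> cells (n - 1)"
proof -
  have "\<exists>i\<in>{1..s}. cyc_bd (q i) (\<lambda>y. F (w(i := y))) (w i) \<noteq> 0"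
    using assms(2) tot_bd_eq_0 by blast
  then obtain i where i: "i \<in> {1..s}" and nz: "cyc_bd (q i) (\<lambda>y. F (w(i := y))) (w i) \<noteq> 0" by blast
  \<comment> \<open>As \<open>cyc_bd\<close> is zero at junk labels, a nonzero value certifies that
    coordinate \<open>i\<close> is proper.\<close>
  have wi: "snd (w i) < q i"
    using nz by (cases "w i") (auto simp: cyc_bd_def split: if_splits)
  obtain t where "F (w(i := (Suc (fst (w i)), t))) \<noteq> 0"
  proof (rule ccontr)
    assume "\<not> thesis"
    then have "F (w(i := (Suc (fst (w i)), t))) = 0" for t using that by blast
    then show False using nz by (cases "w i") (simp add: cyc_bd_def del: fun_upd_apply split: if_splits)
  qed
  then have cell: "w(i := (Suc (fst (w i)), t)) \<in> cells n" using F by blast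
  have "snd (w j) < q j" if "j \<in> {1..s}" for j
    using cell that wi by (cases "j = i") (auto simp: cells_def split: if_splits)
  moreover have "w j = (0, 0)" if "j \<notin> {1..s}" for j
  proof -
    have "(w(i := (Suc (fst (w i)), t))) j = (0, 0)" using cell that unfolding cells_def by blast
    moreover have "j \<noteq> i" using that i by blast
    ultimately show ?thesis by simp
  qed
  moreover have "n = Suc (\<Sum>j=1..s. fst (w j))"
  proof -
    have "n = (\<Sum>j=1..s. fst ((w(i := (Suc (fst (w i)), t))) j))"
      using cell unfolding cells_def by simp
    also have "\<dots> = Suc (fst (w i)) + (\<Sum>j\<in>{1..s} - {i}. fst ((w(i := (Suc (fst (w i)), t))) j))"
      using i by (subst sum.remove[of _ i]) simp_all
    also have "(\<Sum>j\<in>{1..s} - {i}. fst ((w(i := (Suc (fst (w i)), t))) j)) = (\<Sum>j\<in>{1..s} - {i}. fst (w j))"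
      by (intro sum.cong) auto
    finally show ?thesis using i by (subst sum.remove[of _ i]) simp_all
  qed
  ultimately show ?thesis unfolding cells_def by simp
qed

section \<open>Exactness\<close>

lemma boundary_boundary:
  assumes "p \<in> carrier (PP s G (Suc n))" "0 < n"
  shows "boundary s G a q n (boundary s G a q (Suc n) p) = \<zero>\<^bsub>PP s G (n - 1)\<^esub>"
proof -
  obtain F where "p = chain_poly (Suc n) F" using chain_poly_surj[OF assms(1)] by blast
  then show ?thesis
    using assms(2) by (simp add: boundary_chain_poly tot_bd_bd chain_poly_zero PP_simps)
qed

lemma finite_cells: "finite (cells n)"
  unfolding cells_eq using finite_msets_of_size[of "{1..s}" n] finite_PG by blast

lemma augmentation_chain_poly: "augmentation (chain_poly 0 F {#}) = (\<Sum>w\<in>cells 0. F w)"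
proof -
  have "augmentation (chain_poly 0 F {#}) = (\<Sum>g\<in>carrier PG. F (code {#} g))"
    unfolding chain_poly_def by (simp add: augmentation_sum augmentation_cmul)
  also have "\<dots> = sum F (code {#} ` carrier PG)"
  proof (rule sum.reindex_cong[symmetric, of "code {#}"])
    show "inj_on (code {#}) (carrier PG)"
    proof (rule inj_onI)
      show "g = h" if "g \<in> carrier PG" "h \<in> carrier PG" "code {#} g = code {#} h" for g h
        using inj_onD[OF inj_on_code, of "({#}, g)" "({#}, h)"] that by simp
    qed
  qed simp_all
  also have "code {#} ` carrier PG = cells 0"
    unfolding cells_eq by auto
  finally show ?thesis .
qed

lemma tot_proj_cells:
  assumes "w \<in> cells n" "w \<noteq> (\<lambda>_. (0, 0))"
  shows "tot_proj q s F w = 0"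
proof -
  obtain j where "w j \<noteq> (0, 0)" using assms(2) by blast
  then show ?thesis
    using assms(1) by (intro tot_proj_apply_zero[of j]) (auto simp: cells_def)
qed

text \<open>With \<open>D F = 0\<close> and \<open>T F\<close> zero on \<open>cells n\<close>, the
  homotopy identity reads \<open>D H F = F\<close> there. Values of \<open>H F\<close> off
  \<open>cells (Suc n)\<close> are discarded by \<open>chain_poly\<close>.\<close>

lemma boundary_tot_htp:
  assumes "\<And>w. w \<in> cells n \<Longrightarrow> tot_proj q s F w = 0" "tot_bd q s F = 0"
  shows "boundary s G a q (Suc n) (chain_poly (Suc n) (tot_htp q s F)) = chain_poly n F"
proof -
  have "tot_bd q s (tot_htp q s F) = F - tot_proj q s F"
    using tot_homotopy[of q s F] by (simp only: assms(2) tot_zero add_0_right)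
  then have "\<forall>w\<in>cells n. tot_bd q s (tot_htp q s F) w = F w"
    using assms(1) by simp
  then show ?thesis
    unfolding boundary_chain_poly[OF zero_less_Suc] diff_Suc_1 chain_poly_eq_iff .
qed

lemma boundary_exact:
  assumes p: "p \<in> carrier (PP s G n)" and n: "0 < n"
    and cycle: "boundary s G a q n p = \<zero>\<^bsub>PP s G (n - 1)\<^esub>"
  shows "p \<in> boundary s G a q (Suc n) ` carrier (PP s G (Suc n))"
proof -
  obtain F where F: "p = chain_poly n F" "\<And>w. w \<notin> cells n \<Longrightarrow> F w = 0"
    using chain_poly_surj[OF p] by blast
  have "chain_poly (n - 1) (tot_bd q s F) = chain_poly (n - 1) 0"
    using cycle boundary_chain_poly[OF n, of F] by (simp only: F(1) PP_simps chain_poly_zero)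
  then have "tot_bd q s F w = 0" for w
    using tot_bd_support[where n = n and F = F and w = w, OF F(2)] by (auto simp: chain_poly_eq_iff)
  then have "tot_bd q s F = 0" by (simp add: fun_eq_iff)
  \<comment> \<open>Among cells, \<open>T F\<close> can be nonzero only at the constant label
    \<open>(0, 0)\<close>, which has degree 0 and so lies outside \<open>cells n\<close>.\<close>
  moreover have "tot_proj q s F w = 0" if "w \<in> cells n" for w
    using that n by (intro tot_proj_cells) (auto simp: cells_def)
  ultimately have "boundary s G a q (Suc n) (chain_poly (Suc n) (tot_htp q s F)) = p"
    unfolding F(1) by (intro boundary_tot_htp)
  then show ?thesis using chain_poly_closed by blast
qed

text \<open>With no cells below degree 0 the chain boundary of \<open>F\<close> vanishes by itself;
  what must be shown is that the condition on the augmentation removes \<open>T F\<close>.\<close>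

lemma boundary_exact_0:
  assumes p: "p \<in> carrier (PP s G 0)" and cycle: "augmentation (p {#}) = 0"
  shows "p \<in> boundary s G a q 1 ` carrier (PP s G 1)"
proof -
  obtain F where F: "p = chain_poly 0 F" "\<And>w. w \<notin> cells 0 \<Longrightarrow> F w = 0"
    using chain_poly_surj[OF p] by blast
  have "tot_bd q s F = 0"
  proof
    show "tot_bd q s F w = 0 w" for w
      using tot_bd_support[where n = 0 and F = F and w = w, OF F(2)] by auto
  qed
  let ?w0 = "\<lambda>_. (0, 0) :: nat \<times> nat"
  have w0: "?w0 \<in> cells 0"
  proof -
    have "0 < q i" if "i \<in> {1..s}" for i
      using dlog_less[OF that monoid.one_closed[OF group.is_monoid[OF factor_group[OF that]]]]
      by (rule le_less_trans[OF le0])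
    then show ?thesis by (simp add: cells_def)
  qed
  text \<open>The augmentation kills the boundary of the homotopy, hence also the projection of \<open>F\<close>,
    which is concentrated in the single cell \<open>?w0\<close>.\<close>
  have "tot_bd q s (tot_htp q s F) = F - tot_proj q s F"
    using tot_homotopy[of q s F] by (simp only: \<open>tot_bd q s F = 0\<close> tot_zero add_0_right)
  then have eq: "tot_proj q s F w = F w - tot_bd q s (tot_htp q s F) w" for w by simp
  have "tot_proj q s F ?w0 = (\<Sum>w\<in>cells 0. if w = ?w0 then tot_proj q s F w else 0)"
    using w0 finite_cells by (simp add: sum.delta)
  also have "\<dots> = (\<Sum>w\<in>cells 0. tot_proj q s F w)"
    using tot_proj_cells by (intro sum.cong refl) auto
  also have "\<dots> = (\<Sum>w\<in>cells 0. F w) - (\<Sum>w\<in>cells 0. tot_bd q s (tot_htp q s F) w)"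
    unfolding eq by (rule sum_subtractf)
  also have "(\<Sum>w\<in>cells 0. F w) = 0"
    using cycle unfolding F(1) augmentation_chain_poly .
  also have "(\<Sum>w\<in>cells 0. tot_bd q s (tot_htp q s F) w) = 0"
    using augmentation_boundary[OF chain_poly_closed, of "tot_htp q s F"]
    unfolding boundary_chain_poly[OF zero_less_one] by (simp add: augmentation_chain_poly)
  finally have "tot_proj q s F w = 0" if "w \<in> cells 0" for w
    using tot_proj_cells[OF that, of F] by (cases "w = ?w0") auto
  then have "boundary s G a q 1 (chain_poly 1 (tot_htp q s F)) = p"
    using boundary_tot_htp[of 0 F] \<open>tot_bd q s F = 0\<close> unfolding F(1) by simp
  then show ?thesis using chain_poly_closed by blast
qed

lemma augmentation_hom: "(\<lambda>p. augmentation (p {#})) \<in> module_hom ZG (PP s G 0) trivial_module"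
  by (auto simp: module_hom_def PP_simps augmentation_add augmentation_mult trivial_module_def
      augmentation_def[symmetric] simp flip: sum_distrib_right)

lemma augmentation_surj: "(\<lambda>p. augmentation (p {#})) ` carrier (PP s G 0) = carrier trivial_module"
proof -
  have "z \<in> (\<lambda>p. augmentation (p {#})) ` carrier (PP s G 0)" for z
  proof -
    define p :: "nat multiset \<Rightarrow> (nat \<Rightarrow> 'g) \<Rightarrow>\<^sub>0 int"
      where "p = (\<lambda>m. if m = {#} then frag_cmul z (frag_of \<one>\<^bsub>PG\<^esub>) else 0)"
    have "p \<in> carrier (PP s G 0)"
      using group.is_monoid[OF group_PG, THEN monoid.one_closed]
      by (auto simp: p_def PP_carrier_iff simp del: carrier_product_group one_product_group split: if_splits)
    moreover have "z = augmentation (p {#})" by (simp add: p_def augmentation_cmul)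
    ultimately show ?thesis by blast
  qed
  then show ?thesis by (auto simp: trivial_module_def)
qed

lemma free_resolution_PP:
  "free_resolution ZG (PP s G) (boundary s G a q) (\<lambda>p. augmentation (p {#})) trivial_module"
  unfolding free_resolution_def a_kernel_def'
proof (intro conjI allI impI)
  show "Module.module ZG trivial_module"
    by (rule module_trivial_module[OF comm_group_PG])
  show "free_module ZG (PP s G n)" for n
    using cring.free_module_homogeneous_polys[OF cring_ZG, of "{1..s}" n]
    by (simp add: PP_def cyclic_product_ring_def)
  show "boundary s G a q n \<in> module_hom ZG (PP s G n) (PP s G (n - 1))" for n
    by (rule boundary_hom)
  show "(\<lambda>p. augmentation (p {#})) \<in> module_hom ZG (PP s G 0) trivial_module"
    by (rule augmentation_hom)
  show "(\<lambda>p. augmentation (p {#})) ` carrier (PP s G 0) = carrier trivial_module"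
    by (rule augmentation_surj)
  have "\<zero>\<^bsub>trivial_module\<^esub> = (0::int)" by (simp add: trivial_module_def)
  then show "boundary s G a q 1 ` carrier (PP s G 1)
      = {p \<in> carrier (PP s G 0). augmentation (p {#}) = \<zero>\<^bsub>trivial_module\<^esub>}"
    using boundary_exact_0 boundary_apply(2)[of _ 1] augmentation_boundary by fastforce
  show "boundary s G a q (n + 1) ` carrier (PP s G (n + 1))
      = {p \<in> carrier (PP s G n). boundary s G a q n p = \<zero>\<^bsub>PP s G (n - 1)\<^esub>}" if "n \<ge> 1" for n
    using that boundary_exact[of _ n] boundary_apply(2)[of _ "Suc n"] boundary_boundary[of _ n] by fastforce
qed

end

theorem theorem1p1:
  fixes s :: nat
    and G :: "nat \<Rightarrow> ('g, 'm) monoid_scheme"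
    and a :: "nat \<Rightarrow> 'g"
    and q :: "nat \<Rightarrow> nat"
  assumes "\<And>i. i \<in> {1..s} \<Longrightarrow> group (G i)"
    and "\<And>i. i \<in> {1..s} \<Longrightarrow> a i \<in> carrier (G i)"
    and "\<And>i. i \<in> {1..s} \<Longrightarrow> carrier (G i) = generate (G i) {a i}"
    and "\<And>i. i \<in> {1..s} \<Longrightarrow> finite (carrier (G i))"
    and "\<And>i. i \<in> {1..s} \<Longrightarrow> order (G i) = q i"
  shows "free_resolution (cyclic_product_ring s G) (PP s G) (boundary s G a q)
           (\<lambda>p. augmentation (p {#})) trivial_module"
proof -
  interpret cyclic_factors s G a q
    by (rule cyclic_factors.intro[OF assms])
  show ?thesis
    unfolding cyclic_product_ring_def by (rule free_resolution_PP)
qed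

end
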